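(* With the setting and notation of the context, $$\overline V=\underline V=V.$$ Moreover: (1) The map $\boldsymbol{\rho}^*$ given by $$\boldsymbol{\rho}^*(\tau)=\rho_d 1_{\{\tau>\rho_d\}}+\rho_u(\tau)1_{\{\tau\le\rho_d\}},\qquad \tau\in\mathcal T,$$ belongs to $\mathbb T^{ii}$, the formula $$\tau^*(\boldsymbol{\rho})=\tau_d 1_{\{\tau_d\le\boldsymbol{\rho}(\tau_d)\}}+\tau_u(\boldsymbol{\rho}(\tau_d))1_{\{\tau_d>\boldsymbol{\rho}(\tau_d)\}},\qquad \boldsymbol{\rho}\in\mathbb T^{ii},$$ defines a map $\tau^*:\mathbb T^{ii}\to\mathcal T$, and $$\overline V=\sup_{\tau\in\mathcal T}\mathbb E[U(\boldsymbol{\rho}^*(\tau),\tau)]=\inf_{\boldsymbol{\rho}\in\mathbb T^{ii}}\mathbb E[U(\boldsymbol{\rho}(\tau^*(\boldsymbol{\rho})),\tau^*(\boldsymbol{\rho}))].$$ (2) The map $\boldsymbol{\tau}^{**}$ given by $$\boldsymbol{\tau}^{**}(\rho)=\tau_d 1_{\{\rho\ge\tau_d\}}+\tau_u(\rho)1_{\{\rho<\tau_d\}},\qquad \rho\in\mathcal T,$$ belongs to $\mathbb T^{i}$, the formula $$\rho^{**}(\boldsymbol{\tau})=\rho_d 1_{\{\rho_d<\boldsymbol{\tau}(\rho_d)\}}+\rho_u(\boldsymbol{\tau}(\rho_d))1_{\{\rho_d\ge\boldsymbol{\tau}(\rho_d)\}},\qquad \boldsymbol{\tau}\in\mathbb T^{i},$$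 defines a map $\rho^{**}:\mathbb T^{i}\to\mathcal T$, and $$\underline V=\inf_{\rho\in\mathcal T}\mathbb E[U(\rho,\boldsymbol{\tau}^{**}(\rho))]=\sup_{\boldsymbol{\tau}\in\mathbb T^{i}}\mathbb E[U(\rho^{**}(\boldsymbol{\tau}),\boldsymbol{\tau}(\rho^{**}(\boldsymbol{\tau})))].$$
   Context: Setting. $(\Omega,\mathcal F,P)$ is a probability space, $T\in\mathbb N$, and $\mathbb F=(\mathcal F_t)_{t=0,\dots,T}$ is a filtration enlarged by the $P$-null sets. $U:\{0,\dots,T\}\times\{0,\dots,T\}\times\Omega\to\mathbb R$ is bounded and $U(s,t,\cdot)$ is $\mathcal F_{s\vee t}$-measurable for all $s,t$. Write $\mathbb E_t[\cdot]=\mathbb E[\cdot\,|\,\mathcal F_t]$ (and $\mathbb E_\sigma[\cdot]=\mathbb E[\cdot|\mathcal F_\sigma]$ for a stopping time $\sigma$). $\mathcal T_t$ is the set of $\mathbb F$-stopping times with values in $\{t,\dots,T\}$, and $\mathcal T:=\mathcal T_0$. Relations between random variables are understood $P$-almost surely. Stopping strategies. $\mathbb T^{i}$ (strategies of Type I) is the set of maps $\boldsymbol{\rho}:\mathcal T\to\mathcal T$ such that for all $\sigma_1,\sigma_2\in\mathcal T$, for $P$-a.e. $\omega$, either $\boldsymbol{\rho}(\sigma_1)=\boldsymbol{\rho}(\sigma_2)\le\sigma_1\wedge\sigma_2$ or $\boldsymbol{\rho}(\sigma_1)\wedge\boldsymbol{\rho}(\sigma_2)>\sigma_1\wedge\sigma_2$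 (all evaluated at $\omega$). $\mathbb T^{ii}$ (Type II) is the set of maps $\boldsymbol{\rho}:\mathcal T\to\mathcal T$ such that for all $\sigma_1,\sigma_2\in\mathcal T$, for $P$-a.e. $\omega$, either $\boldsymbol{\rho}(\sigma_1)=\boldsymbol{\rho}(\sigma_2)<\sigma_1\wedge\sigma_2$ or $\boldsymbol{\rho}(\sigma_1)\wedge\boldsymbol{\rho}(\sigma_2)\ge\sigma_1\wedge\sigma_2$. Game values. $$\overline V:=\inf_{\boldsymbol{\rho}\in\mathbb T^{ii}}\sup_{\tau\in\mathcal T}\mathbb E[U(\boldsymbol{\rho}(\tau),\tau)],\qquad \underline V:=\sup_{\boldsymbol{\tau}\in\mathbb T^{i}}\inf_{\rho\in\mathcal T}\mathbb E[U(\rho,\boldsymbol{\tau}(\rho))].$$ Auxiliary processes. $V^1_t:=\operatorname{ess\,inf}_{\rho\in\mathcal T_t}\mathbb E_t[U(\rho,t)]$ for $t=0,\dots,T$; $V^2_t:=\max\{\operatorname{ess\,sup}_{\tau\in\mathcal T_{t+1}}\mathbb E_t[U(t,\tau)],\,V^1_t\}$ for $t=0,\dots,T-1$; $V^2_T:=U(T,T)$. Thus $V^1_t\le V^2_t$. For $t\le T-1$, $\rho_u(t)\in\mathcal T_t$ denotes a fixed optimizer for $V^1_t$, i.e. $\mathbb E_t[U(\rho_u(t),t)]=V^1_t$, and $\tau_u(t)\in\mathcal T_{t+1}$ a fixed optimizer for $\operatorname{ess\,sup}_{\tau\in\mathcal T_{t+1}}\mathbb E_t[U(t,\tau)]$ (such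 optimizers exist by classical optimal stopping theory); $\rho_u(T)=\tau_u(T):=T$. For $\sigma\in\mathcal T$, $\rho_u(\sigma)(\omega):=\rho_u(\sigma(\omega))(\omega)$ and $\tau_u(\sigma)(\omega):=\tau_u(\sigma(\omega))(\omega)$. Dynkin game. Since $V^1\le V^2$, by classical theory of Dynkin games the following are well defined (inf-sup and sup-inf coincide): $$V:=\inf_{\rho\in\mathcal T}\sup_{\tau\in\mathcal T}\mathbb E[V^1_\tau 1_{\{\tau\le\rho\}}+V^2_\rho 1_{\{\tau>\rho\}}]=\sup_{\tau\in\mathcal T}\inf_{\rho\in\mathcal T}\mathbb E[V^1_\tau 1_{\{\tau\le\rho\}}+V^2_\rho 1_{\{\tau>\rho\}}],$$ $$V_t:=\operatorname*{ess\,inf}_{\rho\in\mathcal T_t}\operatorname*{ess\,sup}_{\tau\in\mathcal T_t}\mathbb E_t[V^1_\tau 1_{\{\tau\le\rho\}}+V^2_\rho 1_{\{\tau>\rho\}}]=\operatorname*{ess\,sup}_{\tau\in\mathcal T_t}\operatorname*{ess\,inf}_{\rho\in\mathcal T_t}\mathbb E_t[V^1_\tau 1_{\{\tau\le\rho\}}+V^2_\rho 1_{\{\tau>\rho\}}].$$ Set $\rho_d:=\inf\{s\ge0: V_s=V^2_s\}$ and $\tau_d:=\inf\{s\ge0: V_s=V^1_s\}$. It is classical that $(\rho_d,\tau_d)$ is a saddle point: $V=\sup_{\tau\in\mathcal T}\mathbb E[V^1_\tau 1_{\{\tau\le\rho_d\}}+V^2_{\rho_d}1_{\{\tau>\rho_d\}}]=\inf_{\rho\in\mathcal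 T}\mathbb E[V^1_{\tau_d}1_{\{\tau_d\le\rho\}}+V^2_\rho 1_{\{\tau_d>\rho\}}]$. *)

theory Defs
  imports "HOL-Probability.Probability"
begin

text \<open>
  The library constant \<^const>\<open>esssup\<close> is the essential supremum of a single function (a number).
  Here we need the almost surely least upper bound (greatest lower bound) of a family of real
  random variables, which is again a random variable, unique up to null sets.
  \<open>ess_Sup\<close> and \<open>ess_Inf\<close> pick a version; the choice is meaningful whenever such a bound exists,
  which is the case for every nonempty uniformly bounded family on a probability space.
\<close>

definition is_ess_Sup :: "'a measure \<Rightarrow> ('a \<Rightarrow> real) set \<Rightarrow> ('a \<Rightarrow> real) \<Rightarrow> bool" where
  "is_ess_Sup M A g \<longleftrightarrow>
     g \<in> borel_measurable M \<and>
     (\<forall>f\<in>A. AE \<omega> in M. f \<omega> \<le> g \<omega>) \<and>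
     (\<forall>h\<in>borel_measurable M. (\<forall>f\<in>A. AE \<omega> in M. f \<omega> \<le> h \<omega>) \<longrightarrow> (AE \<omega> in M. g \<omega> \<le> h \<omega>))"

definition is_ess_Inf :: "'a measure \<Rightarrow> ('a \<Rightarrow> real) set \<Rightarrow> ('a \<Rightarrow> real) \<Rightarrow> bool" where
  "is_ess_Inf M A g \<longleftrightarrow>
     g \<in> borel_measurable M \<and>
     (\<forall>f\<in>A. AE \<omega> in M. g \<omega> \<le> f \<omega>) \<and>
     (\<forall>h\<in>borel_measurable M. (\<forall>f\<in>A. AE \<omega> in M. h \<omega> \<le> f \<omega>) \<longrightarrow> (AE \<omega> in M. h \<omega> \<le> g \<omega>))"

definition ess_Sup :: "'a measure \<Rightarrow> ('a \<Rightarrow> real) set \<Rightarrow> 'a \<Rightarrow> real" where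
  "ess_Sup M A = (SOME g. is_ess_Sup M A g)"

definition ess_Inf :: "'a measure \<Rightarrow> ('a \<Rightarrow> real) set \<Rightarrow> 'a \<Rightarrow> real" where
  "ess_Inf M A = (SOME g. is_ess_Inf M A g)"

text \<open>
  The filtration is indexed by all of \<^typ>\<open>nat\<close>, as in the library, but only the indices
  \<open>0, \<dots>, T\<close> matter: for a time bounded by \<open>T\<close> the stopping time condition is void beyond \<open>T\<close>.
\<close>

definition stopping_times :: "(nat \<Rightarrow> 'a measure) \<Rightarrow> nat \<Rightarrow> nat \<Rightarrow> ('a \<Rightarrow> nat) set" where
  "stopping_times F T t = {\<tau>. stopping_time F \<tau> \<and> (\<forall>\<omega>\<in>space (F 0). t \<le> \<tau> \<omega> \<and> \<tau> \<omega> \<le> T)}"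

definition strategies_I ::
  "'a measure \<Rightarrow> (nat \<Rightarrow> 'a measure) \<Rightarrow> nat \<Rightarrow> (('a \<Rightarrow> nat) \<Rightarrow> 'a \<Rightarrow> nat) set" where
  "strategies_I M F T = {r \<in> stopping_times F T 0 \<rightarrow> stopping_times F T 0.
     \<forall>\<sigma>1\<in>stopping_times F T 0. \<forall>\<sigma>2\<in>stopping_times F T 0. AE \<omega> in M.
       (r \<sigma>1 \<omega> = r \<sigma>2 \<omega> \<and> r \<sigma>1 \<omega> \<le> min (\<sigma>1 \<omega>) (\<sigma>2 \<omega>)) \<or>
       min (r \<sigma>1 \<omega>) (r \<sigma>2 \<omega>) > min (\<sigma>1 \<omega>) (\<sigma>2 \<omega>)}"

definition strategies_II ::
  "'a measure \<Rightarrow> (nat \<Rightarrow> 'a measure) \<Rightarrow> nat \<Rightarrow> (('a \<Rightarrow> nat) \<Rightarrow> 'a \<Rightarrow> nat) set" where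
  "strategies_II M F T = {r \<in> stopping_times F T 0 \<rightarrow> stopping_times F T 0.
     \<forall>\<sigma>1\<in>stopping_times F T 0. \<forall>\<sigma>2\<in>stopping_times F T 0. AE \<omega> in M.
       (r \<sigma>1 \<omega> = r \<sigma>2 \<omega> \<and> r \<sigma>1 \<omega> < min (\<sigma>1 \<omega>) (\<sigma>2 \<omega>)) \<or>
       min (r \<sigma>1 \<omega>) (r \<sigma>2 \<omega>) \<ge> min (\<sigma>1 \<omega>) (\<sigma>2 \<omega>)}"

definition payoff ::
  "'a measure \<Rightarrow> (nat \<Rightarrow> nat \<Rightarrow> 'a \<Rightarrow> real) \<Rightarrow> ('a \<Rightarrow> nat) \<Rightarrow> ('a \<Rightarrow> nat) \<Rightarrow> real" where
  "payoff M U \<rho> \<tau> = (\<integral>\<omega>. U (\<rho> \<omega>) (\<tau> \<omega>) \<omega> \<partial>M)"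

definition upper_value ::
  "'a measure \<Rightarrow> (nat \<Rightarrow> 'a measure) \<Rightarrow> nat \<Rightarrow> (nat \<Rightarrow> nat \<Rightarrow> 'a \<Rightarrow> real) \<Rightarrow> real" where
  "upper_value M F T U =
     (INF r\<in>strategies_II M F T. SUP \<tau>\<in>stopping_times F T 0. payoff M U (r \<tau>) \<tau>)"

definition lower_value ::
  "'a measure \<Rightarrow> (nat \<Rightarrow> 'a measure) \<Rightarrow> nat \<Rightarrow> (nat \<Rightarrow> nat \<Rightarrow> 'a \<Rightarrow> real) \<Rightarrow> real" where
  "lower_value M F T U =
     (SUP s\<in>strategies_I M F T. INF \<rho>\<in>stopping_times F T 0. payoff M U \<rho> (s \<rho>))"

definition V1 ::
  "'a measure \<Rightarrow> (nat \<Rightarrow> 'a measure) \<Rightarrow> nat \<Rightarrow> (nat \<Rightarrow> nat \<Rightarrow> 'a \<Rightarrow> real) \<Rightarrow> nat \<Rightarrow> 'a \<Rightarrow> real" where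
  "V1 M F T U t = ess_Inf M
     ((\<lambda>\<rho>. real_cond_exp M (F t) (\<lambda>\<omega>. U (\<rho> \<omega>) t \<omega>)) ` stopping_times F T t)"

definition V2_pre ::
  "'a measure \<Rightarrow> (nat \<Rightarrow> 'a measure) \<Rightarrow> nat \<Rightarrow> (nat \<Rightarrow> nat \<Rightarrow> 'a \<Rightarrow> real) \<Rightarrow> nat \<Rightarrow> 'a \<Rightarrow> real" where
  "V2_pre M F T U t = ess_Sup M
     ((\<lambda>\<tau>. real_cond_exp M (F t) (\<lambda>\<omega>. U t (\<tau> \<omega>) \<omega>)) ` stopping_times F T (Suc t))"

definition V2 ::
  "'a measure \<Rightarrow> (nat \<Rightarrow> 'a measure) \<Rightarrow> nat \<Rightarrow> (nat \<Rightarrow> nat \<Rightarrow> 'a \<Rightarrow> real) \<Rightarrow> nat \<Rightarrow> 'a \<Rightarrow> real" where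
  "V2 M F T U t \<omega> = (if t < T then max (V2_pre M F T U t \<omega>) (V1 M F T U t \<omega>) else U T T \<omega>)"

definition is_rho_u ::
  "'a measure \<Rightarrow> (nat \<Rightarrow> 'a measure) \<Rightarrow> nat \<Rightarrow> (nat \<Rightarrow> nat \<Rightarrow> 'a \<Rightarrow> real) \<Rightarrow> (nat \<Rightarrow> 'a \<Rightarrow> nat) \<Rightarrow> bool" where
  "is_rho_u M F T U \<rho>u \<longleftrightarrow>
     (\<forall>t<T. \<rho>u t \<in> stopping_times F T t \<and>
        (AE \<omega> in M. real_cond_exp M (F t) (\<lambda>\<omega>. U (\<rho>u t \<omega>) t \<omega>) \<omega> = V1 M F T U t \<omega>)) \<and>
     (\<forall>\<omega>\<in>space M. \<rho>u T \<omega> = T)"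

definition is_tau_u ::
  "'a measure \<Rightarrow> (nat \<Rightarrow> 'a measure) \<Rightarrow> nat \<Rightarrow> (nat \<Rightarrow> nat \<Rightarrow> 'a \<Rightarrow> real) \<Rightarrow> (nat \<Rightarrow> 'a \<Rightarrow> nat) \<Rightarrow> bool" where
  "is_tau_u M F T U \<tau>u \<longleftrightarrow>
     (\<forall>t<T. \<tau>u t \<in> stopping_times F T (Suc t) \<and>
        (AE \<omega> in M. real_cond_exp M (F t) (\<lambda>\<omega>. U t (\<tau>u t \<omega>) \<omega>) \<omega> = V2_pre M F T U t \<omega>)) \<and>
     (\<forall>\<omega>\<in>space M. \<tau>u T \<omega> = T)"

definition dynkin_payoff ::
  "'a measure \<Rightarrow> (nat \<Rightarrow> 'a measure) \<Rightarrow> nat \<Rightarrow> (nat \<Rightarrow> nat \<Rightarrow> 'a \<Rightarrow> real) \<Rightarrow>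
   ('a \<Rightarrow> nat) \<Rightarrow> ('a \<Rightarrow> nat) \<Rightarrow> 'a \<Rightarrow> real" where
  "dynkin_payoff M F T U \<rho> \<tau> \<omega> =
     (if \<tau> \<omega> \<le> \<rho> \<omega> then V1 M F T U (\<tau> \<omega>) \<omega> else V2 M F T U (\<rho> \<omega>) \<omega>)"

text \<open>
  For the value of the Dynkin game and its value process we take the inf-sup expressions as
  definitions; it is classical that they agree with the corresponding sup-inf expressions.
\<close>

definition dynkin_value ::
  "'a measure \<Rightarrow> (nat \<Rightarrow> 'a measure) \<Rightarrow> nat \<Rightarrow> (nat \<Rightarrow> nat \<Rightarrow> 'a \<Rightarrow> real) \<Rightarrow> real" where
  "dynkin_value M F T U =
     (INF \<rho>\<in>stopping_times F T 0. SUP \<tau>\<in>stopping_times F T 0.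
        (\<integral>\<omega>. dynkin_payoff M F T U \<rho> \<tau> \<omega> \<partial>M))"

definition dynkin_process ::
  "'a measure \<Rightarrow> (nat \<Rightarrow> 'a measure) \<Rightarrow> nat \<Rightarrow> (nat \<Rightarrow> nat \<Rightarrow> 'a \<Rightarrow> real) \<Rightarrow> nat \<Rightarrow> 'a \<Rightarrow> real" where
  "dynkin_process M F T U t = ess_Inf M
     ((\<lambda>\<rho>. ess_Sup M
         ((\<lambda>\<tau>. real_cond_exp M (F t) (dynkin_payoff M F T U \<rho> \<tau>)) ` stopping_times F T t))
       ` stopping_times F T t)"

text \<open>
  At time \<open>T\<close> the value process agrees with both \<^const>\<open>V1\<close> and \<^const>\<open>V2\<close> almost surely, but
  for a given choice of versions not necessarily everywhere. The disjunct \<open>s = T\<close> below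
  only matters on that null set, where it makes the hitting times take the value \<open>T\<close>.
\<close>

definition rho_d ::
  "'a measure \<Rightarrow> (nat \<Rightarrow> 'a measure) \<Rightarrow> nat \<Rightarrow> (nat \<Rightarrow> nat \<Rightarrow> 'a \<Rightarrow> real) \<Rightarrow> 'a \<Rightarrow> nat" where
  "rho_d M F T U \<omega> = (LEAST s. dynkin_process M F T U s \<omega> = V2 M F T U s \<omega> \<or> s = T)"

definition tau_d ::
  "'a measure \<Rightarrow> (nat \<Rightarrow> 'a measure) \<Rightarrow> nat \<Rightarrow> (nat \<Rightarrow> nat \<Rightarrow> 'a \<Rightarrow> real) \<Rightarrow> 'a \<Rightarrow> nat" where
  "tau_d M F T U \<omega> = (LEAST s. dynkin_process M F T U s \<omega> = V1 M F T U s \<omega> \<or> s = T)"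

definition rho_star ::
  "'a measure \<Rightarrow> (nat \<Rightarrow> 'a measure) \<Rightarrow> nat \<Rightarrow> (nat \<Rightarrow> nat \<Rightarrow> 'a \<Rightarrow> real) \<Rightarrow> (nat \<Rightarrow> 'a \<Rightarrow> nat) \<Rightarrow>
   ('a \<Rightarrow> nat) \<Rightarrow> 'a \<Rightarrow> nat" where
  "rho_star M F T U \<rho>u \<tau> \<omega> =
     (if \<tau> \<omega> > rho_d M F T U \<omega> then rho_d M F T U \<omega> else \<rho>u (\<tau> \<omega>) \<omega>)"

definition tau_star ::
  "'a measure \<Rightarrow> (nat \<Rightarrow> 'a measure) \<Rightarrow> nat \<Rightarrow> (nat \<Rightarrow> nat \<Rightarrow> 'a \<Rightarrow> real) \<Rightarrow> (nat \<Rightarrow> 'a \<Rightarrow> nat) \<Rightarrow>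
   (('a \<Rightarrow> nat) \<Rightarrow> 'a \<Rightarrow> nat) \<Rightarrow> 'a \<Rightarrow> nat" where
  "tau_star M F T U \<tau>u r \<omega> =
     (if tau_d M F T U \<omega> \<le> r (tau_d M F T U) \<omega>
      then tau_d M F T U \<omega> else \<tau>u (r (tau_d M F T U) \<omega>) \<omega>)"

definition tau_star2 ::
  "'a measure \<Rightarrow> (nat \<Rightarrow> 'a measure) \<Rightarrow> nat \<Rightarrow> (nat \<Rightarrow> nat \<Rightarrow> 'a \<Rightarrow> real) \<Rightarrow> (nat \<Rightarrow> 'a \<Rightarrow> nat) \<Rightarrow>
   ('a \<Rightarrow> nat) \<Rightarrow> 'a \<Rightarrow> nat" where
  "tau_star2 M F T U \<tau>u \<rho> \<omega> =
     (if \<rho> \<omega> \<ge> tau_d M F T U \<omega> then tau_d M F T U \<omega> else \<tau>u (\<rho> \<omega>) \<omega>)"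

definition rho_star2 ::
  "'a measure \<Rightarrow> (nat \<Rightarrow> 'a measure) \<Rightarrow> nat \<Rightarrow> (nat \<Rightarrow> nat \<Rightarrow> 'a \<Rightarrow> real) \<Rightarrow> (nat \<Rightarrow> 'a \<Rightarrow> nat) \<Rightarrow>
   (('a \<Rightarrow> nat) \<Rightarrow> 'a \<Rightarrow> nat) \<Rightarrow> 'a \<Rightarrow> nat" where
  "rho_star2 M F T U \<rho>u s \<omega> =
     (if rho_d M F T U \<omega> < s (rho_d M F T U) \<omega>
      then rho_d M F T U \<omega> else \<rho>u (s (rho_d M F T U) \<omega>) \<omega>)"

end

theory Submission
  imports Defs
begin

text \<open>
  Everything is compared with the Dynkin game in which the player who stops first, at time \<open>k\<close>,
  leaves the other player alone with an optimal stopping problem. If the maximiser stops first,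
  the minimiser faces the payoffs \<open>U \<cdot> k\<close> and can bring the conditional payoff down to \<open>V1 k\<close>.
  If the minimiser stops strictly first, the maximiser faces \<open>U k \<cdot>\<close> after \<open>k\<close> and can raise it to
  \<open>V2_pre k\<close>. So a pair \<open>(\<rho>, \<tau>)\<close> of first stopping times is worth \<open>V1 \<tau>\<close> on \<open>{\<tau> \<le> \<rho>}\<close>
  and \<open>V2_pre \<rho>\<close> on \<open>{\<rho> < \<tau>}\<close>; replacing \<open>V2_pre\<close> by its maximum \<open>V2\<close> with \<open>V1\<close>
  (and by \<open>U T T\<close> at the horizon, where nobody is left to choose) makes \<open>V1 \<le> V2\<close>,
  a condition under which a Dynkin game has a saddle point in stopping times.

  The saddle point comes from dynamic programming: the value satisfies
  \<open>v t = min (V2 t) (max (V1 t) (E t (v (t + 1))))\<close>, and each player stops when \<open>v\<close> meets the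
  payoff that stopping yields (\<open>reward_\<rho>_opt_le\<close>, \<open>reward_\<tau>_opt_ge\<close>). The essential
  infimum of essential suprema that defines the value process is almost surely \<open>v\<close>
  (\<open>value_process\<close>), so \<open>\<rho>d\<close> and \<open>\<tau>d\<close> form the saddle point (\<open>saddle_\<rho>d\<close>, \<open>saddle_\<tau>d\<close>).

  Two estimates transfer the saddle point to the original game. If the maximiser's first stopping
  time is \<open>\<tau>\<close> and the minimiser stops at \<open>\<rho>d\<close> unless forestalled, in which case he continues
  optimally by \<open>\<rho>u\<close>, then the payoff is at most the Dynkin value
  (\<open>payoff_upper_estimate\<close>). The opposite estimate for \<open>\<tau>d\<close> and \<open>\<tau>u\<close>
  (\<open>payoff_lower_estimate\<close>) needs that \<open>V2\<close> is not larger than what the maximiser really gets;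
  this holds because \<open>V2 = V2_pre\<close> strictly before \<open>\<tau>d\<close> (\<open>V2_before_\<tau>d\<close>).

  Non-anticipativity is what makes the estimates apply to a pair of a strategy and a reply. The reply
  to a strategy \<open>r\<close> first looks at \<open>r \<tau>d\<close>, the reaction to \<open>\<tau>d\<close>. If the minimiser reacts by
  stopping strictly before \<open>\<tau>d\<close>, the maximiser switches to \<open>\<tau>u\<close>, which
  happens only later, so a strategy of type II cannot revise its decision; otherwise the maximiser
  stops at \<open>\<tau>d\<close>, and the strategy cannot stop before. For type I, strict and weak inequalities
  are exchanged, in accordance with \<open>\<rho>u k \<ge> k\<close> and \<open>\<tau>u k > k\<close>. Thus both in the game with
  strategies of type II and in the one with type I, one strategy and one map of replies
  guarantee the Dynkin value, and these determine all suprema and infima in the claim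
  (\<open>minimax_witnesses\<close>, \<open>maximin_witnesses\<close>).
\<close>

section \<open>Essential suprema and infima that are attained\<close>

lemma is_ess_Sup_attained:
  assumes "g \<in> A" "g \<in> borel_measurable M" "\<And>f. f \<in> A \<Longrightarrow> AE \<omega> in M. f \<omega> \<le> g \<omega>"
  shows "is_ess_Sup M A g"
  using assms unfolding is_ess_Sup_def by blast

lemma is_ess_Inf_attained:
  assumes "g \<in> A" "g \<in> borel_measurable M" "\<And>f. f \<in> A \<Longrightarrow> AE \<omega> in M. g \<omega> \<le> f \<omega>"
  shows "is_ess_Inf M A g"
  using assms unfolding is_ess_Inf_def by blast

lemma is_ess_Sup_unique:
  assumes "is_ess_Sup M A g" "is_ess_Sup M A h"
  shows "AE \<omega> in M. g \<omega> = h \<omega>"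
proof -
  have "AE \<omega> in M. g \<omega> \<le> h \<omega>" "AE \<omega> in M. h \<omega> \<le> g \<omega>"
    using assms unfolding is_ess_Sup_def by blast+
  then show ?thesis by eventually_elim simp
qed

lemma is_ess_Inf_unique:
  assumes "is_ess_Inf M A g" "is_ess_Inf M A h"
  shows "AE \<omega> in M. g \<omega> = h \<omega>"
proof -
  have "AE \<omega> in M. g \<omega> \<le> h \<omega>" "AE \<omega> in M. h \<omega> \<le> g \<omega>"
    using assms unfolding is_ess_Inf_def by blast+
  then show ?thesis by eventually_elim simp
qed

lemma is_ess_Sup_ess_Sup: "is_ess_Sup M A g \<Longrightarrow> is_ess_Sup M A (ess_Sup M A)"
  unfolding ess_Sup_def by (rule someI[of "is_ess_Sup M A"])

lemma is_ess_Inf_ess_Inf: "is_ess_Inf M A g \<Longrightarrow> is_ess_Inf M A (ess_Inf M A)"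
  unfolding ess_Inf_def by (rule someI[of "is_ess_Inf M A"])

section \<open>Conditional expectations along a finite filtration\<close>

locale finite_horizon = prob_space M for M :: "'a measure" +
  fixes F :: "nat \<Rightarrow> 'a measure" and T :: nat
  assumes filt: "filtration (space M) F"
    and subalg: "\<And>t. t \<le> T \<Longrightarrow> subalgebra M (F t)"
    and null_in_F0: "null_sets M \<subseteq> sets (F 0)"
begin

abbreviation stops :: "nat \<Rightarrow> ('a \<Rightarrow> nat) set" where
  "stops \<equiv> stopping_times F T"

abbreviation E :: "nat \<Rightarrow> ('a \<Rightarrow> real) \<Rightarrow> 'a \<Rightarrow> real" where
  "E t \<equiv> real_cond_exp M (F t)"

lemma space_F [simp]: "space (F t) = space M"
  using filt by (simp add: filtration.space_F)

lemma sets_F_mono: "s \<le> t \<Longrightarrow> sets (F s) \<subseteq> sets (F t)"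
  using filt by (simp add: filtration.sets_F_mono)

lemma sets_F_M: "t \<le> T \<Longrightarrow> A \<in> sets (F t) \<Longrightarrow> A \<in> sets M"
  using subalg[of t] by (auto simp: subalgebra_def)

lemma measurable_F_mono: "s \<le> t \<Longrightarrow> f \<in> measurable (F s) N \<Longrightarrow> f \<in> measurable (F t) N"
  using sets_F_mono[of s t] by (auto simp: measurable_def)

lemma measurable_F_M: "t \<le> T \<Longrightarrow> f \<in> measurable (F t) N \<Longrightarrow> f \<in> measurable M N"
  using subalg[of t] by (rule measurable_from_subalg)

lemma cond_exp_algebra: "t \<le> T \<Longrightarrow> sigma_finite_subalgebra M (F t)"
  by (intro finite_measure_subalgebra_is_sigma_finite)
     (simp add: finite_measure_subalgebra_def finite_measure_subalgebra_axioms_def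
        finite_measure_axioms subalg)

text \<open>
  Essential suprema and infima are only \<open>M\<close>-measurable by definition. Because the filtration
  contains all null sets, they inherit adaptedness from any adapted version.
\<close>

lemma measurable_F_AE:
  fixes f g :: "'a \<Rightarrow> real"
  assumes f: "f \<in> borel_measurable (F t)" and g: "g \<in> borel_measurable M"
    and t: "t \<le> T" and eq: "AE \<omega> in M. f \<omega> = g \<omega>"
  shows "g \<in> borel_measurable (F t)"
proof (rule measurableI)
  fix B :: "real set" assume B: "B \<in> sets borel"
  have null: "A \<in> sets (F t)" if "A \<in> null_sets M" for A
    using that null_in_F0 sets_F_mono[of 0 t] by auto
  have fM [measurable]: "f \<in> borel_measurable M" by (rule measurable_F_M[OF t f])
  note [measurable] = g B
  have N: "{\<omega>\<in>space M. f \<omega> \<noteq> g \<omega>} \<in> null_sets M"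
    using eq by (subst (asm) AE_iff_null) auto
  have "{\<omega>\<in>space M. g \<omega> \<in> B} \<in> sets M" by measurable
  then have N': "{\<omega>\<in>space M. f \<omega> \<noteq> g \<omega>} \<inter> {\<omega>\<in>space M. g \<omega> \<in> B} \<in> null_sets M"
    using N by (simp add: null_set_Int2)
  have "g -` B \<inter> space (F t) = (f -` B \<inter> space (F t) - {\<omega>\<in>space M. f \<omega> \<noteq> g \<omega>})
      \<union> ({\<omega>\<in>space M. f \<omega> \<noteq> g \<omega>} \<inter> {\<omega>\<in>space M. g \<omega> \<in> B})"
    by auto
  also have "\<dots> \<in> sets (F t)"
    using null[OF N] null[OF N'] measurable_sets[OF f B] by blast
  finally show "g -` B \<inter> space (F t) \<in> sets (F t)" .
qed simp

lemma E_measurable: "s \<le> t \<Longrightarrow> E s X \<in> borel_measurable (F t)"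
  by (rule measurable_F_mono) auto

lemma integrable_E: "t \<le> T \<Longrightarrow> integrable M X \<Longrightarrow> integrable M (E t X)"
  by (rule sigma_finite_subalgebra.real_cond_exp_int(1)[OF cond_exp_algebra])

lemma E_tower:
  assumes "s \<le> t" "t \<le> T" "integrable M X"
  shows "AE \<omega> in M. E s (E t X) \<omega> = E s X \<omega>"
proof (rule sigma_finite_subalgebra.real_cond_exp_nested_subalg[OF cond_exp_algebra])
  show "subalgebra (F t) (F s)"
    using sets_F_mono[OF assms(1)] by (simp add: subalgebra_def)
qed (use assms subalg in auto)

text \<open>
  Multiplying by the indicator of an event known at time \<open>t\<close> commutes with conditioning, so on such
  an event only the values there matter. This justifies every case distinction made at
  time \<open>t\<close> inside a backward induction.
\<close>

lemma E_local_mono: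
  assumes A: "A \<in> sets (F t)" and t: "t \<le> T" and X: "integrable M X" and Y: "integrable M Y"
    and le: "AE \<omega> in M. \<omega> \<in> A \<longrightarrow> X \<omega> \<le> Y \<omega>"
  shows "AE \<omega> in M. \<omega> \<in> A \<longrightarrow> E t X \<omega> \<le> E t Y \<omega>"
proof -
  note sub = cond_exp_algebra[OF t]
  have AM: "A \<in> sets M" using sets_F_M[OF t A] .
  have iX: "integrable M (\<lambda>\<omega>. indicator A \<omega> * X \<omega>)" and iY: "integrable M (\<lambda>\<omega>. indicator A \<omega> * Y \<omega>)"
    using integrable_mult_indicator[OF AM X] integrable_mult_indicator[OF AM Y] by auto
  have ind: "(indicator A :: 'a \<Rightarrow> real) \<in> borel_measurable (F t)" using A by simp
  have "AE \<omega> in M. indicator A \<omega> * X \<omega> \<le> indicator A \<omega> * Y \<omega>"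
    using le by eventually_elim (auto simp: indicator_def)
  from sigma_finite_subalgebra.real_cond_exp_mono[OF sub this iX iY]
    sigma_finite_subalgebra.real_cond_exp_mult[OF sub ind borel_measurable_integrable[OF X] iX]
    sigma_finite_subalgebra.real_cond_exp_mult[OF sub ind borel_measurable_integrable[OF Y] iY]
  show ?thesis by eventually_elim (auto simp: indicator_def)
qed

lemma E_local_cong:
  assumes "A \<in> sets (F t)" "t \<le> T" "integrable M X" "integrable M Y"
    and "AE \<omega> in M. \<omega> \<in> A \<longrightarrow> X \<omega> = Y \<omega>"
  shows "AE \<omega> in M. \<omega> \<in> A \<longrightarrow> E t X \<omega> = E t Y \<omega>"
proof -
  have "AE \<omega> in M. \<omega> \<in> A \<longrightarrow> E t X \<omega> \<le> E t Y \<omega>"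
    by (rule E_local_mono[OF assms(1-4)]) (use assms(5) in eventually_elim, simp)
  moreover have "AE \<omega> in M. \<omega> \<in> A \<longrightarrow> E t Y \<omega> \<le> E t X \<omega>"
    by (rule E_local_mono[OF assms(1,2,4,3)]) (use assms(5) in eventually_elim, simp)
  ultimately show ?thesis by eventually_elim auto
qed

lemma E_local_known:
  assumes "A \<in> sets (F t)" "t \<le> T" "integrable M X" "integrable M Y" "Y \<in> borel_measurable (F t)"
    and "AE \<omega> in M. \<omega> \<in> A \<longrightarrow> X \<omega> = Y \<omega>"
  shows "AE \<omega> in M. \<omega> \<in> A \<longrightarrow> E t X \<omega> = Y \<omega>"
  using E_local_cong[OF assms(1-4,6)]
    sigma_finite_subalgebra.real_cond_exp_F_meas[OF cond_exp_algebra[OF assms(2)] assms(4,5)]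
  by eventually_elim simp

lemma E_mono:
  assumes "t \<le> T" "integrable M X" "integrable M Y" "AE \<omega> in M. X \<omega> \<le> Y \<omega>"
  shows "AE \<omega> in M. E t X \<omega> \<le> E t Y \<omega>"
  by (rule sigma_finite_subalgebra.real_cond_exp_mono[OF cond_exp_algebra[OF assms(1)] assms(4,2,3)])

lemma integral_E_local:
  assumes "A \<in> sets (F t)" "t \<le> T" "integrable M X"
  shows "(\<integral>\<omega>. indicator A \<omega> * E t X \<omega> \<partial>M) = (\<integral>\<omega>. indicator A \<omega> * X \<omega> \<partial>M)"
  using sigma_finite_subalgebra.real_cond_exp_intA[OF cond_exp_algebra[OF assms(2)] assms(3,1)]
  by (simp add: set_lebesgue_integral_def)

lemma E_tower_le:
  assumes t: "t < T" and X: "integrable M X" and Y: "integrable M Y"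
    and le: "AE \<omega> in M. E (Suc t) X \<omega> \<le> Y \<omega>"
  shows "AE \<omega> in M. E t X \<omega> \<le> E t Y \<omega>"
proof -
  have "AE \<omega> in M. E t (E (Suc t) X) \<omega> \<le> E t Y \<omega>"
    by (rule E_mono[OF _ _ Y le]) (use t X in \<open>auto intro!: integrable_E\<close>)
  moreover have "AE \<omega> in M. E t (E (Suc t) X) \<omega> = E t X \<omega>"
    by (rule E_tower) (use t X in auto)
  ultimately show ?thesis by eventually_elim simp
qed

lemma E_tower_ge:
  assumes t: "t < T" and X: "integrable M X" and Y: "integrable M Y"
    and le: "AE \<omega> in M. Y \<omega> \<le> E (Suc t) X \<omega>"
  shows "AE \<omega> in M. E t Y \<omega> \<le> E t X \<omega>"
proof -
  have "AE \<omega> in M. E t Y \<omega> \<le> E t (E (Suc t) X) \<omega>"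
    by (rule E_mono[OF _ Y _ le]) (use t X in \<open>auto intro!: integrable_E\<close>)
  moreover have "AE \<omega> in M. E t (E (Suc t) X) \<omega> = E t X \<omega>"
    by (rule E_tower) (use t X in auto)
  ultimately show ?thesis by eventually_elim simp
qed

text \<open>
  A choice among finitely many random variables is a finite sum of products with indicators, so no
  joint measurability in the index and the outcome is required.
\<close>

lemma measurable_finite_choice:
  fixes X :: "'i \<Rightarrow> 'a \<Rightarrow> real"
  assumes "finite I" "\<And>\<omega>. \<omega> \<in> space N \<Longrightarrow> \<kappa> \<omega> \<in> I" "\<And>i. i \<in> I \<Longrightarrow> {\<omega>\<in>space N. \<kappa> \<omega> = i} \<in> sets N"
    and "\<And>i. i \<in> I \<Longrightarrow> X i \<in> borel_measurable N"
  shows "(\<lambda>\<omega>. X (\<kappa> \<omega>) \<omega>) \<in> borel_measurable N"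
proof -
  have "(\<lambda>\<omega>. \<Sum>i\<in>I. indicator {\<omega>\<in>space N. \<kappa> \<omega> = i} \<omega> * X i \<omega>) \<in> borel_measurable N"
    using assms by (intro borel_measurable_sum borel_measurable_times borel_measurable_indicator) auto
  moreover have "(\<Sum>i\<in>I. indicator {\<omega>\<in>space N. \<kappa> \<omega> = i} \<omega> * X i \<omega>) = X (\<kappa> \<omega>) \<omega>"
    if "\<omega> \<in> space N" for \<omega>
    using that assms(1,2) by (auto simp: indicator_def if_distrib[of "\<lambda>x. x * _"] cong: if_cong)
  ultimately show ?thesis by (subst measurable_cong[symmetric])
qed

lemma integrable_finite_choice:
  fixes X :: "'i \<Rightarrow> 'a \<Rightarrow> real"
  assumes "finite I" "\<And>\<omega>. \<omega> \<in> space M \<Longrightarrow> \<kappa> \<omega> \<in> I" "\<And>i. i \<in> I \<Longrightarrow> {\<omega>\<in>space M. \<kappa> \<omega> = i} \<in> sets M"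
    and "\<And>i. i \<in> I \<Longrightarrow> integrable M (X i)"
  shows "integrable M (\<lambda>\<omega>. X (\<kappa> \<omega>) \<omega>)"
proof (rule Bochner_Integration.integrable_bound)
  show "integrable M (\<lambda>\<omega>. \<Sum>i\<in>I. \<bar>X i \<omega>\<bar>)" using assms(4) by auto
  show "(\<lambda>\<omega>. X (\<kappa> \<omega>) \<omega>) \<in> borel_measurable M"
    by (rule measurable_finite_choice[OF assms(1-3)]) (use assms(4) in auto)
  show "AE \<omega> in M. norm (X (\<kappa> \<omega>) \<omega>) \<le> norm (\<Sum>i\<in>I. \<bar>X i \<omega>\<bar>)"
  proof (rule AE_I2)
    fix \<omega> assume "\<omega> \<in> space M"
    then have "\<bar>X (\<kappa> \<omega>) \<omega>\<bar> \<le> (\<Sum>i\<in>I. \<bar>X i \<omega>\<bar>)"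
      using assms(1,2) by (intro member_le_sum[of _ I "\<lambda>i. \<bar>X i \<omega>\<bar>"]) auto
    then show "norm (X (\<kappa> \<omega>) \<omega>) \<le> norm (\<Sum>i\<in>I. \<bar>X i \<omega>\<bar>)" by simp
  qed
qed

text \<open>
  This is conditioning at a random time: a finite label tells at which time to condition, and the label
  is known at that time. Working with the pieces avoids the \<open>\<sigma>\<close>-algebra of a stopping time.
\<close>

lemma integral_E_pieces:
  fixes \<kappa> :: "'a \<Rightarrow> 'i" and time :: "'i \<Rightarrow> nat"
  assumes I: "finite I" "\<And>\<omega>. \<omega> \<in> space M \<Longrightarrow> \<kappa> \<omega> \<in> I" and X: "integrable M X"
    and ev: "\<And>i. i \<in> I \<Longrightarrow> {\<omega>\<in>space M. \<kappa> \<omega> = i} \<in> sets (F (time i))"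
    and time: "\<And>i. i \<in> I \<Longrightarrow> time i \<le> T"
  shows "integrable M (\<lambda>\<omega>. E (time (\<kappa> \<omega>)) X \<omega>)"
    and "(\<integral>\<omega>. E (time (\<kappa> \<omega>)) X \<omega> \<partial>M) = (\<integral>\<omega>. X \<omega> \<partial>M)"
proof -
  define C where "C i = {\<omega>\<in>space M. \<kappa> \<omega> = i}" for i
  have CM: "C i \<in> sets M" if "i \<in> I" for i
    unfolding C_def by (rule sets_F_M[OF time[OF that] ev[OF that]])
  show "integrable M (\<lambda>\<omega>. E (time (\<kappa> \<omega>)) X \<omega>)"
    using CM integrable_E[OF time X]
    by (intro integrable_finite_choice[of I \<kappa> "\<lambda>i. E (time i) X", OF I]) (simp_all add: C_def)
  have split: "(\<Sum>i\<in>I. indicator (C i) \<omega> * f i \<omega>) = f (\<kappa> \<omega>) \<omega>" if "\<omega> \<in> space M"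
    for f :: "'i \<Rightarrow> 'a \<Rightarrow> real" and \<omega>
  proof -
    have "(\<Sum>i\<in>I. indicator (C i) \<omega> * f i \<omega>) = (\<Sum>i\<in>I. if i = \<kappa> \<omega> then f i \<omega> else 0)"
      by (rule sum.cong) (use that in \<open>auto simp: C_def indicator_def\<close>)
    then show ?thesis using I that by simp
  qed
  have int: "integrable M (\<lambda>\<omega>. indicator (C i) \<omega> * f \<omega>)" if "i \<in> I" "integrable M f"
    for i and f :: "'a \<Rightarrow> real"
    using integrable_mult_indicator[OF CM[OF that(1)] that(2)] by simp
  have "(\<integral>\<omega>. E (time (\<kappa> \<omega>)) X \<omega> \<partial>M) = (\<integral>\<omega>. (\<Sum>i\<in>I. indicator (C i) \<omega> * E (time i) X \<omega>) \<partial>M)"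
    by (rule Bochner_Integration.integral_cong) (simp_all add: split[of _ "\<lambda>i. E (time i) X"])
  also have "\<dots> = (\<Sum>i\<in>I. \<integral>\<omega>. indicator (C i) \<omega> * E (time i) X \<omega> \<partial>M)"
    by (rule Bochner_Integration.integral_sum) (auto intro!: int integrable_E time X)
  also have "\<dots> = (\<Sum>i\<in>I. \<integral>\<omega>. indicator (C i) \<omega> * X \<omega> \<partial>M)"
    by (rule sum.cong[OF refl], rule integral_E_local) (use ev time X in \<open>auto simp: C_def\<close>)
  also have "\<dots> = (\<integral>\<omega>. (\<Sum>i\<in>I. indicator (C i) \<omega> * X \<omega>) \<partial>M)"
    by (rule Bochner_Integration.integral_sum[symmetric]) (auto intro!: int X)
  also have "\<dots> = (\<integral>\<omega>. X \<omega> \<partial>M)"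
    by (rule Bochner_Integration.integral_cong) (simp_all add: split[of _ "\<lambda>i. X"])
  finally show "(\<integral>\<omega>. E (time (\<kappa> \<omega>)) X \<omega> \<partial>M) = (\<integral>\<omega>. X \<omega> \<partial>M)" .
qed

lemma AE_pieces:
  assumes "finite I" "\<And>\<omega>. \<omega> \<in> space M \<Longrightarrow> \<kappa> \<omega> \<in> I"
    and "\<And>i. i \<in> I \<Longrightarrow> AE \<omega> in M. \<kappa> \<omega> = i \<longrightarrow> P i \<omega>"
  shows "AE \<omega> in M. P (\<kappa> \<omega>) \<omega>"
proof -
  have "AE \<omega> in M. \<forall>i\<in>I. \<kappa> \<omega> = i \<longrightarrow> P i \<omega>"
    using assms(3) unfolding AE_finite_all[OF assms(1)] by blast
  then show ?thesis using AE_space by eventually_elim (use assms(2) in blast)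
qed

section \<open>Stopping times with values in a finite set\<close>

lemma stops_range: "\<tau> \<in> stops t \<Longrightarrow> \<omega> \<in> space M \<Longrightarrow> t \<le> \<tau> \<omega> \<and> \<tau> \<omega> \<le> T"
  by (auto simp: stopping_times_def)

lemma stops_pred_le: "\<tau> \<in> stops t \<Longrightarrow> j \<le> k \<Longrightarrow> Measurable.pred (F k) (\<lambda>\<omega>. \<tau> \<omega> \<le> j)"
  by (rule measurable_F_mono[of j]) (auto simp: stopping_times_def stopping_time_def)

lemma stops_pred_gt: "\<tau> \<in> stops t \<Longrightarrow> j \<le> k \<Longrightarrow> Measurable.pred (F k) (\<lambda>\<omega>. j < \<tau> \<omega>)"
  using stops_pred_le[of \<tau> t j k] by (simp add: not_le[symmetric])

lemma stops_pred_eq: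
  assumes "\<tau> \<in> stops t" "j \<le> k"
  shows "Measurable.pred (F k) (\<lambda>\<omega>. \<tau> \<omega> = j)"
proof (cases j)
  case 0
  then show ?thesis using stops_pred_le[OF assms] by simp
next
  case (Suc i)
  have [measurable]: "Measurable.pred (F k) (\<lambda>\<omega>. \<tau> \<omega> \<le> j)" "Measurable.pred (F k) (\<lambda>\<omega>. i < \<tau> \<omega>)"
    using stops_pred_le[OF assms] stops_pred_gt[OF assms(1), of i k] Suc assms(2) by auto
  have "Measurable.pred (F k) (\<lambda>\<omega>. \<tau> \<omega> \<le> j \<and> i < \<tau> \<omega>)" by measurable
  also have "(\<lambda>\<omega>. \<tau> \<omega> \<le> j \<and> i < \<tau> \<omega>) = (\<lambda>\<omega>. \<tau> \<omega> = j)" using Suc by auto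
  finally show ?thesis .
qed

lemma stops_pred_ge:
  assumes "\<tau> \<in> stops t" "j \<le> Suc k"
  shows "Measurable.pred (F k) (\<lambda>\<omega>. j \<le> \<tau> \<omega>)"
proof (cases j)
  case (Suc i)
  then show ?thesis using stops_pred_gt[OF assms(1), of i k] assms(2) by (simp add: Suc_le_eq)
qed simp

lemma set_of_pred: "Measurable.pred (F t) P \<Longrightarrow> {\<omega>\<in>space M. P \<omega>} \<in> sets (F t)"
  by (simp add: pred_def)

lemma stopsI:
  assumes "\<And>\<omega>. \<omega> \<in> space M \<Longrightarrow> t \<le> \<tau> \<omega>" "\<And>\<omega>. \<omega> \<in> space M \<Longrightarrow> \<tau> \<omega> \<le> T"
    and eq: "\<And>k. k \<le> T \<Longrightarrow> Measurable.pred (F k) (\<lambda>\<omega>. \<tau> \<omega> = k)"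
  shows "\<tau> \<in> stops t"
proof -
  have "Measurable.pred (F k) (\<lambda>\<omega>. \<tau> \<omega> \<le> k)" for k
  proof -
    have "Measurable.pred (F k) (\<lambda>\<omega>. \<exists>j\<in>{..min k T}. \<tau> \<omega> = j)"
      by (intro pred_intros_finite) (auto intro: measurable_F_mono[OF _ eq])
    moreover have "(\<exists>j\<in>{..min k T}. \<tau> \<omega> = j) \<longleftrightarrow> \<tau> \<omega> \<le> k" if "\<omega> \<in> space (F k)" for \<omega>
      using assms(2)[of \<omega>] that by auto
    ultimately show ?thesis by (subst measurable_cong[symmetric])
  qed
  then show ?thesis using assms(1,2) by (auto simp: stopping_times_def stopping_time_def)
qed

lemma stops_mono: "s \<le> t \<Longrightarrow> stops t \<subseteq> stops s"
  by (auto simp: stopping_times_def)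

lemma const_in_stops: "t \<le> k \<Longrightarrow> k \<le> T \<Longrightarrow> (\<lambda>_. k) \<in> stops t"
  by (auto simp: stopping_times_def stopping_time_const)

lemma max_in_stops: "\<tau> \<in> stops s \<Longrightarrow> t \<le> T \<Longrightarrow> (\<lambda>\<omega>. max (\<tau> \<omega>) t) \<in> stops t"
  by (auto simp: stopping_times_def intro!: stopping_time_max stopping_time_const)

lemma stops_event_M:
  assumes "\<tau> \<in> stops t"
  shows "{\<omega>\<in>space M. \<tau> \<omega> = k} \<in> sets M"
proof (cases "k \<le> T")
  case True
  show ?thesis by (rule sets_F_M[OF True set_of_pred[OF stops_pred_eq[OF assms order_refl]]])
next
  case False
  then have "{\<omega>\<in>space M. \<tau> \<omega> = k} = {}" using stops_range[OF assms] by auto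
  then show ?thesis by (simp only: sets.empty_sets)
qed

lemma stops_measurable: "\<tau> \<in> stops t \<Longrightarrow> \<tau> \<in> measurable M (count_space UNIV)"
  using stops_event_M[of \<tau> t]
  by (auto simp: measurable_count_space_eq2_countable vimage_def Int_def conj_commute)

lemma integrable_stopped:
  fixes X :: "nat \<Rightarrow> 'a \<Rightarrow> real"
  assumes "\<tau> \<in> stops t" "\<And>s. t \<le> s \<Longrightarrow> s \<le> T \<Longrightarrow> integrable M (X s)"
  shows "integrable M (\<lambda>\<omega>. X (\<tau> \<omega>) \<omega>)"
  by (rule integrable_finite_choice[of "{t..T}" \<tau> X])
     (use stops_range[OF assms(1)] stops_event_M[OF assms(1)] assms(2) in auto)

text \<open>
  The step by which stopping rules are built backwards in time.
\<close>

lemma switch_in_stops: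
  assumes P: "Measurable.pred (F t) P" and \<sigma>: "\<sigma> \<in> stops (Suc t)" and t: "t < T"
  shows "(\<lambda>\<omega>. if P \<omega> then t else \<sigma> \<omega>) \<in> stops t"
proof (rule stopsI)
  fix k assume k: "k \<le> T"
  show "Measurable.pred (F k) (\<lambda>\<omega>. (if P \<omega> then t else \<sigma> \<omega>) = k)"
  proof (cases "t \<le> k")
    case True
    have [measurable]: "Measurable.pred (F k) P" "Measurable.pred (F k) (\<lambda>\<omega>. \<sigma> \<omega> = k)"
      using measurable_F_mono[OF True P] stops_pred_eq[OF \<sigma>, of k k] by auto
    have "Measurable.pred (F k) (\<lambda>\<omega>. (P \<omega> \<and> t = k) \<or> (\<not> P \<omega> \<and> \<sigma> \<omega> = k))" by measurable
    also have "(\<lambda>\<omega>. (P \<omega> \<and> t = k) \<or> (\<not> P \<omega> \<and> \<sigma> \<omega> = k)) = (\<lambda>\<omega>. (if P \<omega> then t else \<sigma> \<omega>) = k)"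
      by auto
    finally show ?thesis .
  next
    case False
    have "Measurable.pred (F k) (\<lambda>\<omega>. False)" by simp
    moreover have "False \<longleftrightarrow> (if P \<omega> then t else \<sigma> \<omega>) = k" if "\<omega> \<in> space (F k)" for \<omega>
      using stops_range[OF \<sigma>, of \<omega>] that False by auto
    ultimately show ?thesis by (subst measurable_cong[symmetric])
  qed
qed (use stops_range[OF \<sigma>] t in \<open>force split: if_splits\<close>)+

text \<open>
  Whether the pasted time equals \<open>k\<close> is decided at time \<open>k\<close>, because \<open>u j\<close> is at least \<open>j\<close>:
  only switches at times \<open>j \<le> k\<close> can lead to stopping at \<open>k\<close>.
\<close>

lemma paste_after_less_in_stops:
  assumes a: "a \<in> stops 0" and b: "b \<in> stops 0" and u: "\<And>k. k \<le> T \<Longrightarrow> u k \<in> stops k"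
  shows "(\<lambda>\<omega>. if a \<omega> < b \<omega> then a \<omega> else u (b \<omega>) \<omega>) \<in> stops 0"
proof (rule stopsI)
  fix \<omega> assume "\<omega> \<in> space M"
  then show "(if a \<omega> < b \<omega> then a \<omega> else u (b \<omega>) \<omega>) \<le> T"
    using stops_range[OF a] stops_range[OF b] stops_range[OF u] by auto
next
  fix k assume k: "k \<le> T"
  have [measurable]: "Measurable.pred (F k) (\<lambda>\<omega>. a \<omega> = k)" "Measurable.pred (F k) (\<lambda>\<omega>. k < b \<omega>)"
    using stops_pred_eq[OF a, of k k] stops_pred_gt[OF b, of k k] by auto
  have "Measurable.pred (F k) (\<lambda>\<omega>. \<exists>j\<in>{..k}. b \<omega> = j \<and> j \<le> a \<omega> \<and> u j \<omega> = k)"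
  proof (rule pred_intros_finite)
    fix j assume "j \<in> {..k}"
    then have [measurable]: "Measurable.pred (F k) (\<lambda>\<omega>. b \<omega> = j)"
      "Measurable.pred (F k) (\<lambda>\<omega>. j \<le> a \<omega>)" "Measurable.pred (F k) (\<lambda>\<omega>. u j \<omega> = k)"
      using stops_pred_eq[OF b, of j k] stops_pred_ge[OF a, of j k] stops_pred_eq[OF u, of j k k] k by auto
    show "Measurable.pred (F k) (\<lambda>\<omega>. b \<omega> = j \<and> j \<le> a \<omega> \<and> u j \<omega> = k)" by measurable
  qed simp
  then have "Measurable.pred (F k)
      (\<lambda>\<omega>. (a \<omega> = k \<and> k < b \<omega>) \<or> (\<exists>j\<in>{..k}. b \<omega> = j \<and> j \<le> a \<omega> \<and> u j \<omega> = k))" by measurable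
  moreover have "(a \<omega> = k \<and> k < b \<omega>) \<or> (\<exists>j\<in>{..k}. b \<omega> = j \<and> j \<le> a \<omega> \<and> u j \<omega> = k) \<longleftrightarrow>
      (if a \<omega> < b \<omega> then a \<omega> else u (b \<omega>) \<omega>) = k" if "\<omega> \<in> space (F k)" for \<omega>
    using that stops_range[OF b, of \<omega>] stops_range[OF u, of "b \<omega>" \<omega>] by auto
  ultimately show "Measurable.pred (F k) (\<lambda>\<omega>. (if a \<omega> < b \<omega> then a \<omega> else u (b \<omega>) \<omega>) = k)"
    by (subst measurable_cong[symmetric])
qed simp

text \<open>
  A switch happens only strictly before \<open>a\<close>, hence before \<open>T\<close>. Rules that start strictly after the
  switch, which do not exist at \<open>T\<close>, therefore fit in for \<open>u\<close>.
\<close>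

lemma paste_after_le_in_stops:
  assumes a: "a \<in> stops 0" and b: "b \<in> stops 0" and u: "\<And>k. k < T \<Longrightarrow> u k \<in> stops k"
  shows "(\<lambda>\<omega>. if a \<omega> \<le> b \<omega> then a \<omega> else u (b \<omega>) \<omega>) \<in> stops 0"
proof (rule stopsI)
  fix \<omega> assume \<omega>: "\<omega> \<in> space M"
  show "(if a \<omega> \<le> b \<omega> then a \<omega> else u (b \<omega>) \<omega>) \<le> T"
    using stops_range[OF a \<omega>] stops_range[OF b \<omega>] stops_range[OF u[of "b \<omega>"] \<omega>] by auto
next
  fix k assume k: "k \<le> T"
  have [measurable]: "Measurable.pred (F k) (\<lambda>\<omega>. a \<omega> = k)" "Measurable.pred (F k) (\<lambda>\<omega>. k \<le> b \<omega>)"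
    using stops_pred_eq[OF a, of k k] stops_pred_ge[OF b, of k k] by auto
  have "Measurable.pred (F k) (\<lambda>\<omega>. \<exists>j\<in>{..k} \<inter> {..<T}. b \<omega> = j \<and> j < a \<omega> \<and> u j \<omega> = k)"
  proof (rule pred_intros_finite)
    fix j assume "j \<in> {..k} \<inter> {..<T}"
    then have [measurable]: "Measurable.pred (F k) (\<lambda>\<omega>. b \<omega> = j)"
      "Measurable.pred (F k) (\<lambda>\<omega>. j < a \<omega>)" "Measurable.pred (F k) (\<lambda>\<omega>. u j \<omega> = k)"
      using stops_pred_eq[OF b, of j k] stops_pred_gt[OF a, of j k] stops_pred_eq[OF u, of j k k] by auto
    show "Measurable.pred (F k) (\<lambda>\<omega>. b \<omega> = j \<and> j < a \<omega> \<and> u j \<omega> = k)" by measurable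
  qed simp
  then have "Measurable.pred (F k) (\<lambda>\<omega>. (a \<omega> = k \<and> k \<le> b \<omega>) \<or>
      (\<exists>j\<in>{..k} \<inter> {..<T}. b \<omega> = j \<and> j < a \<omega> \<and> u j \<omega> = k))" by measurable
  moreover have "(a \<omega> = k \<and> k \<le> b \<omega>) \<or> (\<exists>j\<in>{..k} \<inter> {..<T}. b \<omega> = j \<and> j < a \<omega> \<and> u j \<omega> = k) \<longleftrightarrow>
      (if a \<omega> \<le> b \<omega> then a \<omega> else u (b \<omega>) \<omega>) = k" if "\<omega> \<in> space (F k)" for \<omega>
    using that stops_range[OF a, of \<omega>] stops_range[OF u, of "b \<omega>" \<omega>] by auto
  ultimately show "Measurable.pred (F k) (\<lambda>\<omega>. (if a \<omega> \<le> b \<omega> then a \<omega> else u (b \<omega>) \<omega>) = k)"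
    by (subst measurable_cong[symmetric])
qed simp

end

text \<open>
  The disjunct \<open>s = T\<close> makes the value \<open>T\<close> when \<open>P\<close> fails from \<open>t \<le> T\<close> up to the horizon. The
  starting time \<open>t\<close> is a parameter so that hitting times can be unfolded one step at a time.
\<close>

definition first_hit :: "(nat \<Rightarrow> 'a \<Rightarrow> bool) \<Rightarrow> nat \<Rightarrow> nat \<Rightarrow> 'a \<Rightarrow> nat" where
  "first_hit P T t \<omega> = (LEAST s. t \<le> s \<and> (P s \<omega> \<or> s = T))"

lemma first_hit_end: "first_hit P T T \<omega> = T"
  unfolding first_hit_def by (rule Least_equality) auto

lemma first_hit_step:
  assumes "t < T"
  shows "first_hit P T t \<omega> = (if P t \<omega> then t else first_hit P T (Suc t) \<omega>)"
proof (cases "P t \<omega>")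
  case True
  then show ?thesis unfolding first_hit_def by (auto intro: Least_equality)
next
  case False
  with assms have "(t \<le> s \<and> (P s \<omega> \<or> s = T)) = (Suc t \<le> s \<and> (P s \<omega> \<or> s = T))" for s
    by (cases "s = t") auto
  then show ?thesis using False unfolding first_hit_def by simp
qed

lemma first_hit_before: "t \<le> s \<Longrightarrow> s < first_hit P T t \<omega> \<Longrightarrow> \<not> P s \<omega>"
  unfolding first_hit_def using not_less_Least by blast

lemma first_hit_cong:
  assumes "t \<le> T" "\<And>s. s < T \<Longrightarrow> P s \<omega> = Q s \<omega>"
  shows "first_hit P T t \<omega> = first_hit Q T t \<omega>"
  using assms(1)
proof (induction t rule: inc_induct)
  case (step t)
  then show ?case using assms(2)[of t] by (simp add: first_hit_step)
qed (simp add: first_hit_end)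

lemma (in finite_horizon) first_hit_in_stops:
  assumes "t \<le> T" "\<And>s. t \<le> s \<Longrightarrow> s < T \<Longrightarrow> Measurable.pred (F s) (P s)"
  shows "first_hit P T t \<in> stops t"
  using assms
proof (induction t rule: inc_induct)
  case base
  have "first_hit P T T = (\<lambda>_. T)" by (rule ext) (rule first_hit_end)
  then show ?case using const_in_stops[of T T] by simp
next
  case (step t)
  then have "(\<lambda>\<omega>. if P t \<omega> then t else first_hit P T (Suc t) \<omega>) \<in> stops t"
    by (intro switch_in_stops) auto
  moreover have "first_hit P T t = (\<lambda>\<omega>. if P t \<omega> then t else first_hit P T (Suc t) \<omega>)"
    using first_hit_step[OF step.hyps(2), of P] by blast
  ultimately show ?case by simp
qed

context finite_horizon
begin

section \<open>Optimal stopping\<close>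

text \<open>
  Backward induction: given an optimal rule \<open>\<sigma>'\<close> from \<open>t + 1\<close> on, it is
  optimal to stop at \<open>t\<close> exactly if \<open>X t\<close> is at least the conditional expectation
  \<open>c\<close> of the payoff under \<open>\<sigma>'\<close>. Any rule then yields at most \<open>max (X t) c\<close>: where it stops
  at \<open>t\<close> it yields \<open>X t\<close>, and where it does not, it agrees with a rule starting at \<open>t + 1\<close>.
\<close>

lemma optimal_stopping_ex:
  assumes "t \<le> T"
    and "\<And>s. t \<le> s \<Longrightarrow> s \<le> T \<Longrightarrow> X s \<in> borel_measurable (F s)"
    and "\<And>s. t \<le> s \<Longrightarrow> s \<le> T \<Longrightarrow> integrable M (X s)"
  shows "\<exists>\<tau>\<in>stops t. \<forall>\<sigma>\<in>stops t.
    AE \<omega> in M. E t (\<lambda>\<omega>. X (\<sigma> \<omega>) \<omega>) \<omega> \<le> E t (\<lambda>\<omega>. X (\<tau> \<omega>) \<omega>) \<omega>"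
  using assms
proof (induction t rule: inc_induct)
  case base
  show ?case
  proof (intro bexI[of _ "\<lambda>_. T"] ballI)
    fix \<sigma> assume \<sigma>: "\<sigma> \<in> stops T"
    show "AE \<omega> in M. E T (\<lambda>\<omega>. X (\<sigma> \<omega>) \<omega>) \<omega> \<le> E T (\<lambda>\<omega>. X T \<omega>) \<omega>"
    proof (rule E_mono)
      show "AE \<omega> in M. X (\<sigma> \<omega>) \<omega> \<le> X T \<omega>"
      proof (rule AE_I2)
        fix \<omega> assume "\<omega> \<in> space M"
        then have "\<sigma> \<omega> = T" using stops_range[OF \<sigma>, of \<omega>] by simp
        then show "X (\<sigma> \<omega>) \<omega> \<le> X T \<omega>" by simp
      qed
    qed (use base(2) integrable_stopped[OF \<sigma>, of X] in auto)
  qed (simp add: const_in_stops)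
next
  case (step t)
  from step.IH step.prems obtain \<sigma>' where \<sigma>': "\<sigma>' \<in> stops (Suc t)"
    and opt: "\<And>\<sigma>. \<sigma> \<in> stops (Suc t) \<Longrightarrow>
      AE \<omega> in M. E (Suc t) (\<lambda>\<omega>. X (\<sigma> \<omega>) \<omega>) \<omega> \<le> E (Suc t) (\<lambda>\<omega>. X (\<sigma>' \<omega>) \<omega>) \<omega>"
    by auto
  have tT: "t \<le> T" "t < T" using step.hyps by auto
  note int = step.prems(2)
  define c where "c = E t (\<lambda>\<omega>. X (\<sigma>' \<omega>) \<omega>)"
  have cm [measurable]: "c \<in> borel_measurable (F t)" unfolding c_def by auto
  have Xm [measurable]: "X t \<in> borel_measurable (F t)" using step.prems(1)[of t] tT by auto
  have Xi: "integrable M (X t)" using int tT by auto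
  have \<sigma>'_t: "\<sigma>' \<in> stops t" using \<sigma>' stops_mono[of t "Suc t"] by auto
  have i\<sigma>': "integrable M (\<lambda>\<omega>. X (\<sigma>' \<omega>) \<omega>)" by (rule integrable_stopped[OF \<sigma>'_t int])
  have P: "Measurable.pred (F t) (\<lambda>\<omega>. c \<omega> \<le> X t \<omega>)" by measurable
  define \<tau> where "\<tau> = (\<lambda>\<omega>. if c \<omega> \<le> X t \<omega> then t else \<sigma>' \<omega>)"
  have \<tau>: "\<tau> \<in> stops t" unfolding \<tau>_def by (rule switch_in_stops[OF P \<sigma>' tT(2)])
  have i\<tau>: "integrable M (\<lambda>\<omega>. X (\<tau> \<omega>) \<omega>)" by (rule integrable_stopped[OF \<tau> int])
  have "AE \<omega> in M. \<omega> \<in> {\<omega>\<in>space M. c \<omega> \<le> X t \<omega>} \<longrightarrow> E t (\<lambda>\<omega>. X (\<tau> \<omega>) \<omega>) \<omega> = X t \<omega>"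
    by (rule E_local_known[OF set_of_pred[OF P] tT(1) i\<tau> Xi Xm]) (simp add: \<tau>_def)
  moreover have "AE \<omega> in M. \<omega> \<in> {\<omega>\<in>space M. \<not> c \<omega> \<le> X t \<omega>} \<longrightarrow>
      E t (\<lambda>\<omega>. X (\<tau> \<omega>) \<omega>) \<omega> = E t (\<lambda>\<omega>. X (\<sigma>' \<omega>) \<omega>) \<omega>"
    by (rule E_local_cong[OF set_of_pred tT(1) i\<tau> i\<sigma>']) (auto simp: \<tau>_def)
  ultimately have val: "AE \<omega> in M. E t (\<lambda>\<omega>. X (\<tau> \<omega>) \<omega>) \<omega> = max (X t \<omega>) (c \<omega>)"
    using AE_space by eventually_elim (auto simp: c_def)
  have "AE \<omega> in M. E t (\<lambda>\<omega>. X (\<sigma> \<omega>) \<omega>) \<omega> \<le> max (X t \<omega>) (c \<omega>)" if \<sigma>: "\<sigma> \<in> stops t" for \<sigma>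
  proof -
    define \<sigma>2 where "\<sigma>2 = (\<lambda>\<omega>. max (\<sigma> \<omega>) (Suc t))"
    have \<sigma>2: "\<sigma>2 \<in> stops (Suc t)" unfolding \<sigma>2_def using max_in_stops[OF \<sigma>] tT by auto
    then have \<sigma>2_t: "\<sigma>2 \<in> stops t" using stops_mono[of t "Suc t"] by auto
    have i\<sigma>: "integrable M (\<lambda>\<omega>. X (\<sigma> \<omega>) \<omega>)" and i\<sigma>2: "integrable M (\<lambda>\<omega>. X (\<sigma>2 \<omega>) \<omega>)"
      by (rule integrable_stopped[OF \<sigma> int] integrable_stopped[OF \<sigma>2_t int]; simp)+
    have 1: "AE \<omega> in M. \<omega> \<in> {\<omega>\<in>space M. \<sigma> \<omega> \<le> t} \<longrightarrow> E t (\<lambda>\<omega>. X (\<sigma> \<omega>) \<omega>) \<omega> = X t \<omega>"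
      by (rule E_local_known[OF set_of_pred[OF stops_pred_le[OF \<sigma> order_refl]] tT(1) i\<sigma> Xi Xm])
        (rule AE_I2, use stops_range[OF \<sigma>] in force)
    have 2: "AE \<omega> in M. \<omega> \<in> {\<omega>\<in>space M. t < \<sigma> \<omega>} \<longrightarrow> E t (\<lambda>\<omega>. X (\<sigma> \<omega>) \<omega>) \<omega> = E t (\<lambda>\<omega>. X (\<sigma>2 \<omega>) \<omega>) \<omega>"
      by (rule E_local_cong[OF set_of_pred[OF stops_pred_gt[OF \<sigma> order_refl]] tT(1) i\<sigma> i\<sigma>2])
        (rule AE_I2, auto simp: \<sigma>2_def max_def le_Suc_eq)
    have "AE \<omega> in M. E t (E (Suc t) (\<lambda>\<omega>. X (\<sigma>2 \<omega>) \<omega>)) \<omega> \<le> E t (E (Suc t) (\<lambda>\<omega>. X (\<sigma>' \<omega>) \<omega>)) \<omega>"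
      by (rule E_mono[OF tT(1) _ _ opt[OF \<sigma>2]]) (use tT i\<sigma>2 i\<sigma>' in \<open>auto intro!: integrable_E\<close>)
    moreover have "AE \<omega> in M. E t (E (Suc t) (\<lambda>\<omega>. X (\<sigma>2 \<omega>) \<omega>)) \<omega> = E t (\<lambda>\<omega>. X (\<sigma>2 \<omega>) \<omega>) \<omega>"
      "AE \<omega> in M. E t (E (Suc t) (\<lambda>\<omega>. X (\<sigma>' \<omega>) \<omega>)) \<omega> = c \<omega>"
      unfolding c_def by (rule E_tower; use tT i\<sigma>2 i\<sigma>' in simp)+
    ultimately have "AE \<omega> in M. E t (\<lambda>\<omega>. X (\<sigma>2 \<omega>) \<omega>) \<omega> \<le> c \<omega>"
      by eventually_elim simp
    with 1 2 AE_space show ?thesis by eventually_elim (auto simp: not_le[symmetric] le_max_iff_disj)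
  qed
  note bound = this
  have "AE \<omega> in M. E t (\<lambda>\<omega>. X (\<sigma> \<omega>) \<omega>) \<omega> \<le> E t (\<lambda>\<omega>. X (\<tau> \<omega>) \<omega>) \<omega>" if "\<sigma> \<in> stops t" for \<sigma>
    using val bound[OF that] by eventually_elim simp
  with \<tau> show ?case by blast
qed

lemma optimal_stopping_min_ex:
  assumes "t \<le> T"
    and X: "\<And>s. t \<le> s \<Longrightarrow> s \<le> T \<Longrightarrow> X s \<in> borel_measurable (F s)"
    and int: "\<And>s. t \<le> s \<Longrightarrow> s \<le> T \<Longrightarrow> integrable M (X s)"
  shows "\<exists>\<tau>\<in>stops t. \<forall>\<sigma>\<in>stops t.
    AE \<omega> in M. E t (\<lambda>\<omega>. X (\<tau> \<omega>) \<omega>) \<omega> \<le> E t (\<lambda>\<omega>. X (\<sigma> \<omega>) \<omega>) \<omega>"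
proof -
  have neg: "AE \<omega> in M. E t (\<lambda>\<omega>. - X (\<sigma> \<omega>) \<omega>) \<omega> = - E t (\<lambda>\<omega>. X (\<sigma> \<omega>) \<omega>) \<omega>"
    if "\<sigma> \<in> stops t" for \<sigma>
    using sigma_finite_subalgebra.real_cond_exp_cmult[OF cond_exp_algebra[OF assms(1)]
        integrable_stopped[of \<sigma> t X, OF that int], of "-1"] by simp
  obtain \<tau> where \<tau>: "\<tau> \<in> stops t" and opt: "\<And>\<sigma>. \<sigma> \<in> stops t \<Longrightarrow>
      AE \<omega> in M. E t (\<lambda>\<omega>. - X (\<sigma> \<omega>) \<omega>) \<omega> \<le> E t (\<lambda>\<omega>. - X (\<tau> \<omega>) \<omega>) \<omega>"
    using optimal_stopping_ex[of t "\<lambda>s \<omega>. - X s \<omega>"] assms by auto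
  have "AE \<omega> in M. E t (\<lambda>\<omega>. X (\<tau> \<omega>) \<omega>) \<omega> \<le> E t (\<lambda>\<omega>. X (\<sigma> \<omega>) \<omega>) \<omega>" if "\<sigma> \<in> stops t" for \<sigma>
    using opt[OF that] neg[OF that] neg[OF \<tau>] by eventually_elim simp
  with \<tau> show ?thesis by blast
qed

end

section \<open>Dynkin games\<close>

text \<open>
  The minimiser picks \<open>\<rho>\<close> and the maximiser \<open>\<tau>\<close>. The payoff is \<open>A\<close> when the maximiser stops first
  or both stop together, and \<open>B\<close> when the minimiser stops strictly first.
\<close>

locale dynkin_game = finite_horizon M F T for M :: "'a measure" and F T +
  fixes A B :: "nat \<Rightarrow> 'a \<Rightarrow> real"
  assumes A_meas: "\<And>s. s \<le> T \<Longrightarrow> A s \<in> borel_measurable (F s)"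
    and B_meas: "\<And>s. s \<le> T \<Longrightarrow> B s \<in> borel_measurable (F s)"
    and A_int: "\<And>s. s \<le> T \<Longrightarrow> integrable M (A s)"
    and B_int: "\<And>s. s \<le> T \<Longrightarrow> integrable M (B s)"
    and A_le_B: "\<And>s. s \<le> T \<Longrightarrow> AE \<omega> in M. A s \<omega> \<le> B s \<omega>"
begin

definition reward :: "('a \<Rightarrow> nat) \<Rightarrow> ('a \<Rightarrow> nat) \<Rightarrow> 'a \<Rightarrow> real" where
  "reward \<rho> \<tau> \<omega> = (if \<tau> \<omega> \<le> \<rho> \<omega> then A (\<tau> \<omega>) \<omega> else B (\<rho> \<omega>) \<omega>)"

text \<open>
  Dynamic programming, indexed by the time that remains until the horizon.
\<close>

primrec backward :: "nat \<Rightarrow> 'a \<Rightarrow> real" where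
  "backward 0 = A T"
| "backward (Suc n) = (\<lambda>\<omega>. min (B (T - Suc n) \<omega>)
     (max (A (T - Suc n) \<omega>) (E (T - Suc n) (backward n) \<omega>)))"

definition v :: "nat \<Rightarrow> 'a \<Rightarrow> real" where
  "v t = backward (T - t)"

lemma v_end: "v T = A T"
  by (simp add: v_def)

lemma v_step: "t < T \<Longrightarrow> v t \<omega> = min (B t \<omega>) (max (A t \<omega>) (E t (v (Suc t)) \<omega>))"
  using Suc_diff_Suc[of t T] by (simp add: v_def flip: Suc_diff_Suc)

lemma v_regular:
  assumes "t \<le> T"
  shows "v t \<in> borel_measurable (F t) \<and> integrable M (v t)"
  using assms
proof (induction t rule: inc_induct)
  case base
  show ?case using A_meas A_int by (simp add: v_end)
next
  case (step t)
  have "v t = (\<lambda>\<omega>. min (B t \<omega>) (max (A t \<omega>) (E t (v (Suc t)) \<omega>)))"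
    using v_step[OF step.hyps(2)] by blast
  then show ?case
    using step A_meas[of t] A_int[of t] B_meas[of t] B_int[of t] integrable_E[of t "v (Suc t)"]
    by (auto intro!: Bochner_Integration.integrable_min Bochner_Integration.integrable_max)
qed

lemmas v_meas = v_regular[THEN conjunct1] and v_int = v_regular[THEN conjunct2]

lemma A_le_v: "t \<le> T \<Longrightarrow> AE \<omega> in M. A t \<omega> \<le> v t \<omega>"
  using A_le_B[of t] by (cases "t = T") (auto simp: v_end v_step)

lemma v_le_B: "t \<le> T \<Longrightarrow> AE \<omega> in M. v t \<omega> \<le> B t \<omega>"
  using A_le_B[of t] by (cases "t = T") (auto simp: v_end v_step)

definition \<rho>_opt :: "nat \<Rightarrow> 'a \<Rightarrow> nat" where
  "\<rho>_opt = first_hit (\<lambda>s \<omega>. v s \<omega> = B s \<omega>) T"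

definition \<tau>_opt :: "nat \<Rightarrow> 'a \<Rightarrow> nat" where
  "\<tau>_opt = first_hit (\<lambda>s \<omega>. v s \<omega> = A s \<omega>) T"

lemma pred_v_eq_B: "t \<le> T \<Longrightarrow> Measurable.pred (F t) (\<lambda>\<omega>. v t \<omega> = B t \<omega>)"
  using v_meas[of t] B_meas[of t] by measurable

lemma pred_v_eq_A: "t \<le> T \<Longrightarrow> Measurable.pred (F t) (\<lambda>\<omega>. v t \<omega> = A t \<omega>)"
  using v_meas[of t] A_meas[of t] by measurable

lemma \<rho>_opt_in_stops: "t \<le> T \<Longrightarrow> \<rho>_opt t \<in> stops t"
  unfolding \<rho>_opt_def by (rule first_hit_in_stops) (auto intro: pred_v_eq_B)

lemma \<tau>_opt_in_stops: "t \<le> T \<Longrightarrow> \<tau>_opt t \<in> stops t"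
  unfolding \<tau>_opt_def by (rule first_hit_in_stops) (auto intro: pred_v_eq_A)

lemma reward_int:
  assumes "\<rho> \<in> stops t" "\<tau> \<in> stops t"
  shows "integrable M (reward \<rho> \<tau>)"
proof -
  define X where "X b = (if b then (\<lambda>\<omega>. A (\<tau> \<omega>) \<omega>) else (\<lambda>\<omega>. B (\<rho> \<omega>) \<omega>))" for b
  have [measurable]: "(\<lambda>\<omega>. real (\<rho> \<omega>)) \<in> borel_measurable M" "(\<lambda>\<omega>. real (\<tau> \<omega>)) \<in> borel_measurable M"
    using assms by (auto intro: measurable_compose[OF stops_measurable])
  have ev: "Measurable.pred M (\<lambda>\<omega>. real (\<tau> \<omega>) \<le> real (\<rho> \<omega>))" by measurable
  have sets: "{\<omega>\<in>space M. (\<tau> \<omega> \<le> \<rho> \<omega>) = b} \<in> sets M" for b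
    using ev pred_intros_logic(2)[OF ev] by (cases b) (simp_all add: pred_def)
  have int: "integrable M (X b)" for b
    using integrable_stopped[of \<tau> t A, OF assms(2) A_int] integrable_stopped[of \<rho> t B, OF assms(1) B_int]
    by (cases b) (simp_all add: X_def)
  have "integrable M (\<lambda>\<omega>. X (\<tau> \<omega> \<le> \<rho> \<omega>) \<omega>)"
    by (rule integrable_finite_choice[of UNIV "\<lambda>\<omega>. \<tau> \<omega> \<le> \<rho> \<omega>" X, OF finite UNIV_I sets int])
  also have "(\<lambda>\<omega>. X (\<tau> \<omega> \<le> \<rho> \<omega>) \<omega>) = reward \<rho> \<tau>"
    by (auto simp: X_def reward_def)
  finally show ?thesis .
qed

text \<open>
  Three cases at time \<open>t\<close>. Where the maximiser stops, he gets \<open>A t \<le> v t\<close>. Where \<open>v t = B t\<close>, the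
  minimiser stops and pays at most \<open>B t\<close>, by \<open>A t \<le> B t\<close>. Where both continue,
  \<open>v t \<noteq> B t\<close> forces \<open>E t (v (t + 1)) \<le> v t\<close>, and the induction hypothesis applies.
\<close>

lemma reward_\<rho>_opt_le:
  assumes "t \<le> T" "\<tau> \<in> stops t"
  shows "AE \<omega> in M. E t (reward (\<rho>_opt t) \<tau>) \<omega> \<le> v t \<omega>"
  using assms
proof (induction t arbitrary: \<tau> rule: inc_induct)
  case base
  have "AE \<omega> in M. \<omega> \<in> space M \<longrightarrow> E T (reward (\<rho>_opt T) \<tau>) \<omega> = A T \<omega>"
  proof (rule E_local_known)
    show "AE \<omega> in M. \<omega> \<in> space M \<longrightarrow> reward (\<rho>_opt T) \<tau> \<omega> = A T \<omega>"
    proof (intro AE_I2 impI)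
      fix \<omega> assume "\<omega> \<in> space M"
      then have "\<tau> \<omega> = T" using stops_range[OF base, of \<omega>] by simp
      then show "reward (\<rho>_opt T) \<tau> \<omega> = A T \<omega>"
        by (simp add: reward_def \<rho>_opt_def first_hit_end)
    qed
    show "integrable M (reward (\<rho>_opt T) \<tau>)"
      by (rule reward_int[OF \<rho>_opt_in_stops base]) simp
    show "space M \<in> sets (F T)" using sets.top[of "F T"] by simp
  qed (use A_meas A_int in auto)
  then show ?case using AE_space by eventually_elim (simp add: v_end)
next
  case (step t)
  have tT: "t \<le> T" "t < T" using step.hyps by auto
  define \<rho> where "\<rho> = \<rho>_opt t"
  define \<rho>2 where "\<rho>2 = \<rho>_opt (Suc t)"
  define \<tau>2 where "\<tau>2 = (\<lambda>\<omega>. max (\<tau> \<omega>) (Suc t))"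
  have \<rho>_cases: "\<rho> \<omega> = (if v t \<omega> = B t \<omega> then t else \<rho>2 \<omega>)" for \<omega>
    using first_hit_step[OF tT(2)] unfolding \<rho>_def \<rho>2_def \<rho>_opt_def .
  have \<rho>: "\<rho> \<in> stops t" unfolding \<rho>_def by (rule \<rho>_opt_in_stops[OF tT(1)])
  have \<rho>2: "\<rho>2 \<in> stops (Suc t)" unfolding \<rho>2_def using tT by (intro \<rho>_opt_in_stops) auto
  have \<tau>2: "\<tau>2 \<in> stops (Suc t)" unfolding \<tau>2_def using tT by (intro max_in_stops[OF step.prems]) auto
  note int = reward_int[OF \<rho> step.prems] and int2 = reward_int[OF \<rho>2 \<tau>2]
  have 1: "AE \<omega> in M. \<omega> \<in> {\<omega>\<in>space M. \<tau> \<omega> \<le> t} \<longrightarrow> E t (reward \<rho> \<tau>) \<omega> = A t \<omega>"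
    by (rule E_local_known[OF set_of_pred[OF stops_pred_le[OF step.prems order_refl]] tT(1) int])
      (use A_int A_meas tT stops_range[OF \<rho>] stops_range[OF step.prems] in \<open>force simp: reward_def\<close>)+
  have 2: "AE \<omega> in M. \<omega> \<in> {\<omega>\<in>space M. v t \<omega> = B t \<omega>} \<longrightarrow> E t (reward \<rho> \<tau>) \<omega> \<le> E t (B t) \<omega>"
  proof (rule E_local_mono[OF set_of_pred[OF pred_v_eq_B[OF tT(1)]] tT(1) int B_int[OF tT(1)]])
    show "AE \<omega> in M. \<omega> \<in> {\<omega>\<in>space M. v t \<omega> = B t \<omega>} \<longrightarrow> reward \<rho> \<tau> \<omega> \<le> B t \<omega>"
      using A_le_B[OF tT(1)] AE_space
      by eventually_elim (use stops_range[OF step.prems] in \<open>force simp: reward_def \<rho>_cases\<close>)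
  qed
  have 3: "AE \<omega> in M. \<omega> \<in> {\<omega>\<in>space M. \<not> v t \<omega> = B t \<omega> \<and> t < \<tau> \<omega>} \<longrightarrow>
      E t (reward \<rho> \<tau>) \<omega> = E t (reward \<rho>2 \<tau>2) \<omega>"
    by (rule E_local_cong[OF set_of_pred tT(1) int int2])
      (use pred_v_eq_B[OF tT(1)] stops_pred_gt[OF step.prems order_refl] in
        \<open>auto simp: reward_def \<rho>_cases \<tau>2_def max_absorb1\<close>)
  have "AE \<omega> in M. E t (reward \<rho>2 \<tau>2) \<omega> \<le> E t (v (Suc t)) \<omega>"
    by (rule E_tower_le[OF tT(2) int2 v_int])
      (use tT step.IH[OF \<tau>2] in \<open>auto simp: \<rho>2_def\<close>)
  moreover have "AE \<omega> in M. E t (B t) \<omega> = B t \<omega>"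
    using E_local_known[of "space M" t "B t" "B t"] sets.top[of "F t"] tT(1) B_int B_meas
    by (auto elim!: AE_mp)
  ultimately show ?case
    using 1 2 3 A_le_v[OF tT(1)] AE_space unfolding \<rho>_def[symmetric]
  proof eventually_elim
    case (elim \<omega>)
    then show ?case using v_step[OF tT(2), of \<omega>]
      by (cases "v t \<omega> = B t \<omega>"; cases "\<tau> \<omega> \<le> t") auto
  qed
qed

text \<open>
  Where \<open>v t = A t\<close>, the maximiser stops and gets \<open>A t\<close> whatever the minimiser does,
  because ties are resolved in favour of \<open>A\<close>. Elsewhere, the
  minimiser either stops alone and pays \<open>B t \<ge> v t\<close>, or both continue, and then \<open>v t > A t\<close>
  forces \<open>v t \<le> E t (v (t + 1))\<close>.
\<close>

lemma reward_\<tau>_opt_ge: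
  assumes "t \<le> T" "\<rho> \<in> stops t"
  shows "AE \<omega> in M. v t \<omega> \<le> E t (reward \<rho> (\<tau>_opt t)) \<omega>"
  using assms
proof (induction t arbitrary: \<rho> rule: inc_induct)
  case base
  have "AE \<omega> in M. \<omega> \<in> space M \<longrightarrow> E T (reward \<rho> (\<tau>_opt T)) \<omega> = A T \<omega>"
  proof (rule E_local_known)
    show "AE \<omega> in M. \<omega> \<in> space M \<longrightarrow> reward \<rho> (\<tau>_opt T) \<omega> = A T \<omega>"
      using stops_range[OF base] by (intro AE_I2) (simp add: reward_def \<tau>_opt_def first_hit_end)
    show "integrable M (reward \<rho> (\<tau>_opt T))"
      by (rule reward_int[OF base \<tau>_opt_in_stops]) simp
    show "space M \<in> sets (F T)" using sets.top[of "F T"] by simp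
  qed (use A_meas A_int in auto)
  then show ?case using AE_space by eventually_elim (simp add: v_end)
next
  case (step t)
  have tT: "t \<le> T" "t < T" using step.hyps by auto
  define \<tau> where "\<tau> = \<tau>_opt t"
  define \<tau>2 where "\<tau>2 = \<tau>_opt (Suc t)"
  define \<rho>2 where "\<rho>2 = (\<lambda>\<omega>. max (\<rho> \<omega>) (Suc t))"
  have \<tau>_cases: "\<tau> \<omega> = (if v t \<omega> = A t \<omega> then t else \<tau>2 \<omega>)" for \<omega>
    using first_hit_step[OF tT(2)] unfolding \<tau>_def \<tau>2_def \<tau>_opt_def .
  have \<tau>: "\<tau> \<in> stops t" unfolding \<tau>_def by (rule \<tau>_opt_in_stops[OF tT(1)])
  have \<tau>2: "\<tau>2 \<in> stops (Suc t)" unfolding \<tau>2_def using tT by (intro \<tau>_opt_in_stops) auto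
  have \<rho>2: "\<rho>2 \<in> stops (Suc t)" unfolding \<rho>2_def using tT by (intro max_in_stops[OF step.prems]) auto
  note int = reward_int[OF step.prems \<tau>] and int2 = reward_int[OF \<rho>2 \<tau>2]
  have 1: "AE \<omega> in M. \<omega> \<in> {\<omega>\<in>space M. v t \<omega> = A t \<omega>} \<longrightarrow> E t (reward \<rho> \<tau>) \<omega> = A t \<omega>"
    by (rule E_local_known[OF set_of_pred[OF pred_v_eq_A[OF tT(1)]] tT(1) int])
      (use A_int A_meas tT stops_range[OF step.prems] in \<open>force simp: reward_def \<tau>_cases\<close>)+
  have 2: "AE \<omega> in M. \<omega> \<in> {\<omega>\<in>space M. \<not> v t \<omega> = A t \<omega> \<and> \<rho> \<omega> \<le> t} \<longrightarrow>
      E t (reward \<rho> \<tau>) \<omega> = B t \<omega>"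
  proof (rule E_local_known[OF set_of_pred tT(1) int B_int[OF tT(1)] B_meas[OF tT(1)]])
    show "AE \<omega> in M. \<omega> \<in> {\<omega>\<in>space M. \<not> v t \<omega> = A t \<omega> \<and> \<rho> \<omega> \<le> t} \<longrightarrow> reward \<rho> \<tau> \<omega> = B t \<omega>"
    proof (rule AE_I2, rule impI)
      fix \<omega> assume \<omega>: "\<omega> \<in> space M" "\<omega> \<in> {\<omega>\<in>space M. \<not> v t \<omega> = A t \<omega> \<and> \<rho> \<omega> \<le> t}"
      then have "\<rho> \<omega> = t" "t < \<tau> \<omega>"
        using stops_range[OF step.prems, of \<omega>] stops_range[OF \<tau>2, of \<omega>] by (auto simp: \<tau>_cases)
      then show "reward \<rho> \<tau> \<omega> = B t \<omega>" by (simp add: reward_def)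
    qed
  qed (use pred_v_eq_A[OF tT(1)] stops_pred_le[OF step.prems order_refl] in auto)
  have 3: "AE \<omega> in M. \<omega> \<in> {\<omega>\<in>space M. \<not> v t \<omega> = A t \<omega> \<and> t < \<rho> \<omega>} \<longrightarrow>
      E t (reward \<rho> \<tau>) \<omega> = E t (reward \<rho>2 \<tau>2) \<omega>"
    by (rule E_local_cong[OF set_of_pred tT(1) int int2])
      (use pred_v_eq_A[OF tT(1)] stops_pred_gt[OF step.prems order_refl] in
        \<open>auto simp: reward_def \<tau>_cases \<rho>2_def max_absorb1\<close>)
  have "AE \<omega> in M. E t (v (Suc t)) \<omega> \<le> E t (reward \<rho>2 \<tau>2) \<omega>"
    by (rule E_tower_ge[OF tT(2) int2 v_int])
      (use tT step.IH[OF \<rho>2] in \<open>auto simp: \<tau>2_def\<close>)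
  then show ?case
    using 1 2 3 A_le_v[OF tT(1)] v_le_B[OF tT(1)] AE_space unfolding \<tau>_def[symmetric]
  proof eventually_elim
    case (elim \<omega>)
    then show ?case using v_step[OF tT(2), of \<omega>]
      by (cases "v t \<omega> = A t \<omega>"; cases "\<rho> \<omega> \<le> t") auto
  qed
qed

text \<open>
  Against a fixed \<open>\<rho>\<close> the maximiser stops the adapted process that equals \<open>A\<close> up to \<open>\<rho>\<close> and stays at
  \<open>B \<rho>\<close> afterwards. An optimal reply shows that the inner essential supremum of the
  value process exists.
\<close>

lemma best_reply_ex:
  assumes t: "t \<le> T" and \<rho>: "\<rho> \<in> stops t"
  shows "\<exists>\<tau>\<in>stops t. \<forall>\<sigma>\<in>stops t. AE \<omega> in M. E t (reward \<rho> \<sigma>) \<omega> \<le> E t (reward \<rho> \<tau>) \<omega>"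
proof -
  define Y where "Y s \<omega> = (if s \<le> \<rho> \<omega> then A s \<omega> else B (\<rho> \<omega>) \<omega>)" for s \<omega>
  have reg: "Y s \<in> borel_measurable (F s) \<and> integrable M (Y s)" if s: "t \<le> s" "s \<le> T" for s
  proof -
    define X where "X k = (if k = s then A s else B k)" for k
    have Y: "Y s = (\<lambda>\<omega>. X (min (\<rho> \<omega>) s) \<omega>)" by (auto simp: Y_def X_def min_def)
    have ev: "{\<omega>\<in>space M. min (\<rho> \<omega>) s = k} \<in> sets (F s)" if k: "k \<le> s" for k
    proof (cases "k = s")
      case True
      then have "{\<omega>\<in>space M. min (\<rho> \<omega>) s = k} = {\<omega>\<in>space M. s \<le> \<rho> \<omega>}" by auto
      then show ?thesis using set_of_pred[OF stops_pred_ge[OF \<rho>, of s s]] by simp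
    next
      case False
      then have "{\<omega>\<in>space M. min (\<rho> \<omega>) s = k} = {\<omega>\<in>space M. \<rho> \<omega> = k}" using k by auto
      then show ?thesis using set_of_pred[OF stops_pred_eq[OF \<rho> k]] by simp
    qed
    have "Y s \<in> borel_measurable (F s)" unfolding Y
      by (rule measurable_finite_choice[of "{..s}"])
        (use ev s A_meas measurable_F_mono[OF _ B_meas] in \<open>auto simp: X_def\<close>)
    moreover have "integrable M (Y s)" unfolding Y
      by (rule integrable_finite_choice[of "{..s}"])
        (use sets_F_M[OF s(2) ev] s A_int B_int in \<open>auto simp: X_def\<close>)
    ultimately show ?thesis ..
  qed
  have "reward \<rho> \<sigma> = (\<lambda>\<omega>. Y (\<sigma> \<omega>) \<omega>)" for \<sigma>
    by (auto simp: reward_def Y_def)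
  then show ?thesis using optimal_stopping_ex[of t Y] t reg by auto
qed

text \<open>
  The inner essential supremum \<open>G \<rho>\<close> is at least \<open>v t\<close> for every \<open>\<rho>\<close>, by the reply \<open>\<tau>_opt\<close>, and at
  most \<open>v t\<close> for \<open>\<rho>_opt\<close>. Hence the outer infimum is attained at \<open>\<rho>_opt\<close>.
\<close>

lemma value_process:
  assumes t: "t \<le> T"
  defines "D \<equiv> ess_Inf M ((\<lambda>\<rho>. ess_Sup M ((\<lambda>\<tau>. E t (reward \<rho> \<tau>)) ` stops t)) ` stops t)"
  shows "D \<in> borel_measurable M" "AE \<omega> in M. D \<omega> = v t \<omega>"
proof -
  define G where "G \<rho> = ess_Sup M ((\<lambda>\<tau>. E t (reward \<rho> \<tau>)) ` stops t)" for \<rho>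
  have G: "is_ess_Sup M ((\<lambda>\<tau>. E t (reward \<rho> \<tau>)) ` stops t) (G \<rho>)" if \<rho>: "\<rho> \<in> stops t" for \<rho>
  proof -
    obtain \<tau> where \<tau>: "\<tau> \<in> stops t"
      and best: "\<And>\<sigma>. \<sigma> \<in> stops t \<Longrightarrow> AE \<omega> in M. E t (reward \<rho> \<sigma>) \<omega> \<le> E t (reward \<rho> \<tau>) \<omega>"
      using best_reply_ex[OF t \<rho>] by blast
    have "is_ess_Sup M ((\<lambda>\<tau>. E t (reward \<rho> \<tau>)) ` stops t) (E t (reward \<rho> \<tau>))"
      using \<tau> best measurable_F_M[OF t E_measurable[OF order_refl]]
      by (intro is_ess_Sup_attained) auto
    then show ?thesis unfolding G_def by (rule is_ess_Sup_ess_Sup)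
  qed
  have lower: "AE \<omega> in M. v t \<omega> \<le> G \<rho> \<omega>" if \<rho>: "\<rho> \<in> stops t" for \<rho>
  proof -
    have "AE \<omega> in M. E t (reward \<rho> (\<tau>_opt t)) \<omega> \<le> G \<rho> \<omega>"
      using G[OF \<rho>] \<tau>_opt_in_stops[OF t] unfolding is_ess_Sup_def by blast
    with reward_\<tau>_opt_ge[OF t \<rho>] show ?thesis by eventually_elim simp
  qed
  have upper: "AE \<omega> in M. G (\<rho>_opt t) \<omega> \<le> v t \<omega>"
    using G[OF \<rho>_opt_in_stops[OF t]] reward_\<rho>_opt_le[OF t] borel_measurable_integrable[OF v_int[OF t]]
    unfolding is_ess_Sup_def by blast
  have "is_ess_Inf M (G ` stops t) (G (\<rho>_opt t))"
  proof (rule is_ess_Inf_attained)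
    show "G (\<rho>_opt t) \<in> borel_measurable M"
      using G[OF \<rho>_opt_in_stops[OF t]] by (simp add: is_ess_Sup_def)
    fix f assume "f \<in> G ` stops t"
    then obtain \<rho> where "\<rho> \<in> stops t" "f = G \<rho>" by auto
    with lower[of \<rho>] upper show "AE \<omega> in M. G (\<rho>_opt t) \<omega> \<le> f \<omega>"
      by (auto elim: eventually_elim2)
  qed (use \<rho>_opt_in_stops[OF t] in auto)
  moreover from this have D: "is_ess_Inf M (G ` stops t) D"
    unfolding D_def G_def by (rule is_ess_Inf_ess_Inf)
  ultimately have "AE \<omega> in M. D \<omega> = G (\<rho>_opt t) \<omega>" by (intro is_ess_Inf_unique)
  with upper lower[OF \<rho>_opt_in_stops[OF t]] show "AE \<omega> in M. D \<omega> = v t \<omega>"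
    by eventually_elim simp
  show "D \<in> borel_measurable M" using D by (simp add: is_ess_Inf_def)
qed

text \<open>
  Suprema and infima of real numbers are meaningful only for bounded sets; this bound,
  uniform in both stopping times, serves that purpose.
\<close>

lemma expected_reward_bound:
  assumes "\<rho> \<in> stops 0" "\<tau> \<in> stops 0"
  shows "\<bar>\<integral>\<omega>. reward \<rho> \<tau> \<omega> \<partial>M\<bar> \<le> (\<integral>\<omega>. (\<Sum>s\<le>T. \<bar>A s \<omega>\<bar> + \<bar>B s \<omega>\<bar>) \<partial>M)"
proof -
  have "\<bar>\<integral>\<omega>. reward \<rho> \<tau> \<omega> \<partial>M\<bar> \<le> (\<integral>\<omega>. \<bar>reward \<rho> \<tau> \<omega>\<bar> \<partial>M)" by (rule integral_abs_bound)
  also have "\<dots> \<le> (\<integral>\<omega>. (\<Sum>s\<le>T. \<bar>A s \<omega>\<bar> + \<bar>B s \<omega>\<bar>) \<partial>M)"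
  proof (rule integral_mono)
    fix \<omega> assume \<omega>: "\<omega> \<in> space M"
    have le: "\<bar>A k \<omega>\<bar> + \<bar>B k \<omega>\<bar> \<le> (\<Sum>s\<le>T. \<bar>A s \<omega>\<bar> + \<bar>B s \<omega>\<bar>)" if "k \<le> T" for k
      by (rule member_le_sum[of k "{..T}" "\<lambda>s. \<bar>A s \<omega>\<bar> + \<bar>B s \<omega>\<bar>"]) (use that in auto)
    show "\<bar>reward \<rho> \<tau> \<omega>\<bar> \<le> (\<Sum>s\<le>T. \<bar>A s \<omega>\<bar> + \<bar>B s \<omega>\<bar>)"
      using le[of "\<tau> \<omega>"] le[of "\<rho> \<omega>"] stops_range[OF assms(1) \<omega>] stops_range[OF assms(2) \<omega>]
      by (auto simp: reward_def)
  qed (use reward_int[OF assms] A_int B_int in auto)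
  finally show ?thesis .
qed

lemma saddle_point:
  shows "\<tau> \<in> stops 0 \<Longrightarrow> (\<integral>\<omega>. reward (\<rho>_opt 0) \<tau> \<omega> \<partial>M) \<le> (\<integral>\<omega>. v 0 \<omega> \<partial>M)"
    and "\<rho> \<in> stops 0 \<Longrightarrow> (\<integral>\<omega>. v 0 \<omega> \<partial>M) \<le> (\<integral>\<omega>. reward \<rho> (\<tau>_opt 0) \<omega> \<partial>M)"
proof -
  have E0: "integrable M X \<Longrightarrow> (\<integral>\<omega>. E 0 X \<omega> \<partial>M) = (\<integral>\<omega>. X \<omega> \<partial>M)" for X
    by (rule sigma_finite_subalgebra.real_cond_exp_int(2)[OF cond_exp_algebra]) auto
  note opt = \<rho>_opt_in_stops[of 0, simplified] \<tau>_opt_in_stops[of 0, simplified]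
  show "(\<integral>\<omega>. reward (\<rho>_opt 0) \<tau> \<omega> \<partial>M) \<le> (\<integral>\<omega>. v 0 \<omega> \<partial>M)" if "\<tau> \<in> stops 0"
    unfolding E0[OF reward_int[OF opt(1) that], symmetric]
    using that reward_int[OF opt(1) that] reward_\<rho>_opt_le[of 0 \<tau>]
    by (intro integral_mono_AE integrable_E v_int) auto
  show "(\<integral>\<omega>. v 0 \<omega> \<partial>M) \<le> (\<integral>\<omega>. reward \<rho> (\<tau>_opt 0) \<omega> \<partial>M)" if "\<rho> \<in> stops 0"
    unfolding E0[OF reward_int[OF that opt(2)], symmetric]
    using that reward_int[OF that opt(2)] reward_\<tau>_opt_ge[of 0 \<rho>]
    by (intro integral_mono_AE integrable_E v_int) auto
qed

lemma inf_sup_value: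
  "(INF \<rho>\<in>stops 0. SUP \<tau>\<in>stops 0. (\<integral>\<omega>. reward \<rho> \<tau> \<omega> \<partial>M)) = (\<integral>\<omega>. v 0 \<omega> \<partial>M)"
proof (rule antisym)
  let ?J = "\<lambda>\<rho> \<tau>. \<integral>\<omega>. reward \<rho> \<tau> \<omega> \<partial>M"
  have opt: "\<rho>_opt 0 \<in> stops 0" "\<tau>_opt 0 \<in> stops 0"
    using \<rho>_opt_in_stops[of 0] \<tau>_opt_in_stops[of 0] by auto
  have bdd: "bdd_above (?J \<rho> ` stops 0)" if "\<rho> \<in> stops 0" for \<rho>
    using expected_reward_bound[OF that] by (auto simp: abs_le_iff intro!: bdd_aboveI2)
  have ge: "(\<integral>\<omega>. v 0 \<omega> \<partial>M) \<le> (SUP \<tau>\<in>stops 0. ?J \<rho> \<tau>)" if "\<rho> \<in> stops 0" for \<rho>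
    using saddle_point(2)[OF that] by (rule order_trans) (rule cSUP_upper[OF opt(2) bdd[OF that]])
  show "(\<integral>\<omega>. v 0 \<omega> \<partial>M) \<le> (INF \<rho>\<in>stops 0. SUP \<tau>\<in>stops 0. ?J \<rho> \<tau>)"
    using opt ge by (intro cINF_greatest) auto
  have "(INF \<rho>\<in>stops 0. SUP \<tau>\<in>stops 0. ?J \<rho> \<tau>) \<le> (SUP \<tau>\<in>stops 0. ?J (\<rho>_opt 0) \<tau>)"
    using opt ge by (intro cINF_lower bdd_belowI2) auto
  also have "\<dots> \<le> (\<integral>\<omega>. v 0 \<omega> \<partial>M)"
    using opt saddle_point(1) by (intro cSUP_least) auto
  finally show "(INF \<rho>\<in>stops 0. SUP \<tau>\<in>stops 0. ?J \<rho> \<tau>) \<le> (\<integral>\<omega>. v 0 \<omega> \<partial>M)" .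
qed

end

section \<open>Values at which one player stops first\<close>

locale stopping_game = finite_horizon M F T for M :: "'a measure" and F T +
  fixes U :: "nat \<Rightarrow> nat \<Rightarrow> 'a \<Rightarrow> real"
  assumes U_bdd: "\<exists>C. \<forall>s\<le>T. \<forall>t\<le>T. \<forall>\<omega>\<in>space M. \<bar>U s t \<omega>\<bar> \<le> C"
    and U_meas: "\<And>s t. s \<le> T \<Longrightarrow> t \<le> T \<Longrightarrow> U s t \<in> borel_measurable (F (max s t))"
begin

lemma U_int: "s \<le> T \<Longrightarrow> t \<le> T \<Longrightarrow> integrable M (U s t)"
proof -
  assume st: "s \<le> T" "t \<le> T"
  obtain C where "\<forall>s\<le>T. \<forall>t\<le>T. \<forall>\<omega>\<in>space M. \<bar>U s t \<omega>\<bar> \<le> C" using U_bdd by blast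
  then have "AE \<omega> in M. norm (U s t \<omega>) \<le> C" using st by (intro AE_I2) auto
  moreover have "U s t \<in> borel_measurable M"
    by (rule measurable_F_M[OF _ U_meas]) (use st in auto)
  ultimately show ?thesis by (rule integrable_const_bound)
qed

lemma U_stopped_int:
  assumes \<rho>: "\<rho> \<in> stops 0" and \<tau>: "\<tau> \<in> stops 0"
  shows "integrable M (\<lambda>\<omega>. U (\<rho> \<omega>) (\<tau> \<omega>) \<omega>)"
proof -
  have "integrable M (\<lambda>\<omega>. U s (\<tau> \<omega>) \<omega>)" if "s \<le> T" for s
    by (rule integrable_stopped[OF \<tau>, of "U s"]) (rule U_int[OF that])
  then show ?thesis
    by (intro integrable_stopped[OF \<rho>, of "\<lambda>s \<omega>. U s (\<tau> \<omega>) \<omega>"])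
qed

lemma U_stopped_int1: "t \<le> T \<Longrightarrow> \<rho> \<in> stops s \<Longrightarrow> integrable M (\<lambda>\<omega>. U (\<rho> \<omega>) t \<omega>)"
  by (rule integrable_stopped[of \<rho> s "\<lambda>s. U s t"]) (auto intro: U_int)

lemma U_stopped_int2: "t \<le> T \<Longrightarrow> \<tau> \<in> stops s \<Longrightarrow> integrable M (\<lambda>\<omega>. U t (\<tau> \<omega>) \<omega>)"
  by (rule integrable_stopped[of \<tau> s "U t"]) (auto intro: U_int)

text \<open>
  As optimal stopping attains the infimum, the essential infimum exists and is almost
  surely the conditional payoff of an optimal rule.
\<close>

lemma V1_properties:
  assumes t: "t \<le> T"
  shows V1_le: "\<And>\<rho>. \<rho> \<in> stops t \<Longrightarrow> AE \<omega> in M. V1 M F T U t \<omega> \<le> E t (\<lambda>\<omega>. U (\<rho> \<omega>) t \<omega>) \<omega>"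
    and V1_attained: "\<exists>\<rho>\<in>stops t. AE \<omega> in M. E t (\<lambda>\<omega>. U (\<rho> \<omega>) t \<omega>) \<omega> = V1 M F T U t \<omega>"
    and V1_meas: "V1 M F T U t \<in> borel_measurable (F t)"
    and V1_int: "integrable M (V1 M F T U t)"
proof -
  define L where "L = (\<lambda>\<rho>. E t (\<lambda>\<omega>. U (\<rho> \<omega>) t \<omega>)) ` stops t"
  have U: "U s t \<in> borel_measurable (F s)" "integrable M (U s t)" if "t \<le> s" "s \<le> T" for s
    using U_meas[of s t] U_int[of s t] that t by (auto simp: max_absorb1)
  then obtain \<rho> where \<rho>: "\<rho> \<in> stops t" and opt: "\<And>\<sigma>. \<sigma> \<in> stops t \<Longrightarrow>
      AE \<omega> in M. E t (\<lambda>\<omega>. U (\<rho> \<omega>) t \<omega>) \<omega> \<le> E t (\<lambda>\<omega>. U (\<sigma> \<omega>) t \<omega>) \<omega>"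
    using optimal_stopping_min_ex[OF t, of "\<lambda>s. U s t"] by blast
  have meas: "E t (\<lambda>\<omega>. U (\<rho> \<omega>) t \<omega>) \<in> borel_measurable (F t)" by auto
  have Inf: "is_ess_Inf M L (E t (\<lambda>\<omega>. U (\<rho> \<omega>) t \<omega>))"
    using \<rho> opt measurable_F_M[OF t meas] by (intro is_ess_Inf_attained) (auto simp: L_def)
  then have Inf': "is_ess_Inf M L (V1 M F T U t)"
    unfolding V1_def L_def by (rule is_ess_Inf_ess_Inf)
  have eq: "AE \<omega> in M. E t (\<lambda>\<omega>. U (\<rho> \<omega>) t \<omega>) \<omega> = V1 M F T U t \<omega>"
    by (rule is_ess_Inf_unique[OF Inf Inf'])
  show "AE \<omega> in M. V1 M F T U t \<omega> \<le> E t (\<lambda>\<omega>. U (\<rho> \<omega>) t \<omega>) \<omega>" if "\<rho> \<in> stops t" for \<rho>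
    using Inf' that unfolding is_ess_Inf_def L_def by blast
  show "\<exists>\<rho>\<in>stops t. AE \<omega> in M. E t (\<lambda>\<omega>. U (\<rho> \<omega>) t \<omega>) \<omega> = V1 M F T U t \<omega>"
    using \<rho> eq by blast
  have V1M: "V1 M F T U t \<in> borel_measurable M" using Inf' by (simp add: is_ess_Inf_def)
  then show "V1 M F T U t \<in> borel_measurable (F t)"
    by (rule measurable_F_AE[OF meas _ t eq])
  show "integrable M (V1 M F T U t)"
    using integrable_E[OF t U_stopped_int1[OF t \<rho>]] eq V1M
    by (subst integrable_cong_AE[symmetric]) auto
qed

text \<open>
  The rules start at \<open>t + 1\<close> but the conditioning is at \<open>t\<close>. A rule that is optimal given the
  information at \<open>t + 1\<close> is also optimal given the information at \<open>t\<close>, by the tower property.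
\<close>

lemma V2_pre_properties:
  assumes t: "t < T"
  shows V2_pre_ge: "\<And>\<tau>. \<tau> \<in> stops (Suc t) \<Longrightarrow> AE \<omega> in M. E t (\<lambda>\<omega>. U t (\<tau> \<omega>) \<omega>) \<omega> \<le> V2_pre M F T U t \<omega>"
    and V2_pre_attained:
      "\<exists>\<tau>\<in>stops (Suc t). AE \<omega> in M. E t (\<lambda>\<omega>. U t (\<tau> \<omega>) \<omega>) \<omega> = V2_pre M F T U t \<omega>"
    and V2_pre_meas: "V2_pre M F T U t \<in> borel_measurable (F t)"
    and V2_pre_int: "integrable M (V2_pre M F T U t)"
proof -
  define L where "L = (\<lambda>\<tau>. E t (\<lambda>\<omega>. U t (\<tau> \<omega>) \<omega>)) ` stops (Suc t)"
  have tT: "t \<le> T" "Suc t \<le> T" using t by auto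
  note int = U_stopped_int2[OF tT(1), of _ "Suc t"]
  have U: "U t s \<in> borel_measurable (F s)" "integrable M (U t s)" if "Suc t \<le> s" "s \<le> T" for s
    using U_meas[of t s] U_int[of t s] that t by (auto simp: max_absorb2)
  then obtain \<tau> where \<tau>: "\<tau> \<in> stops (Suc t)" and opt: "\<And>\<sigma>. \<sigma> \<in> stops (Suc t) \<Longrightarrow>
      AE \<omega> in M. E (Suc t) (\<lambda>\<omega>. U t (\<sigma> \<omega>) \<omega>) \<omega> \<le> E (Suc t) (\<lambda>\<omega>. U t (\<tau> \<omega>) \<omega>) \<omega>"
    using optimal_stopping_ex[OF tT(2), of "U t"] by blast
  have opt': "AE \<omega> in M. E t (\<lambda>\<omega>. U t (\<sigma> \<omega>) \<omega>) \<omega> \<le> E t (\<lambda>\<omega>. U t (\<tau> \<omega>) \<omega>) \<omega>"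
    if "\<sigma> \<in> stops (Suc t)" for \<sigma>
    using E_tower_le[OF t int[OF that] integrable_E[OF tT(2) int[OF \<tau>]] opt[OF that]]
      E_tower[of t "Suc t", OF _ tT(2) int[OF \<tau>]]
    by (auto elim: eventually_elim2)
  have meas: "E t (\<lambda>\<omega>. U t (\<tau> \<omega>) \<omega>) \<in> borel_measurable (F t)" by auto
  have Sup: "is_ess_Sup M L (E t (\<lambda>\<omega>. U t (\<tau> \<omega>) \<omega>))"
    using \<tau> opt' measurable_F_M[OF tT(1) meas] by (intro is_ess_Sup_attained) (auto simp: L_def)
  then have Sup': "is_ess_Sup M L (V2_pre M F T U t)"
    unfolding V2_pre_def L_def by (rule is_ess_Sup_ess_Sup)
  have eq: "AE \<omega> in M. E t (\<lambda>\<omega>. U t (\<tau> \<omega>) \<omega>) \<omega> = V2_pre M F T U t \<omega>"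
    by (rule is_ess_Sup_unique[OF Sup Sup'])
  show "AE \<omega> in M. E t (\<lambda>\<omega>. U t (\<tau> \<omega>) \<omega>) \<omega> \<le> V2_pre M F T U t \<omega>" if "\<tau> \<in> stops (Suc t)" for \<tau>
    using Sup' that unfolding is_ess_Sup_def L_def by blast
  show "\<exists>\<tau>\<in>stops (Suc t). AE \<omega> in M. E t (\<lambda>\<omega>. U t (\<tau> \<omega>) \<omega>) \<omega> = V2_pre M F T U t \<omega>"
    using \<tau> eq by blast
  have V2M: "V2_pre M F T U t \<in> borel_measurable M" using Sup' by (simp add: is_ess_Sup_def)
  then show "V2_pre M F T U t \<in> borel_measurable (F t)"
    by (rule measurable_F_AE[OF meas _ tT(1) eq])
  show "integrable M (V2_pre M F T U t)"
    using integrable_E[OF tT(1) int[OF \<tau>]] eq V2M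
    by (subst integrable_cong_AE[symmetric]) auto
qed

lemma E_U_at_end:
  assumes \<rho>: "\<And>\<omega>. \<omega> \<in> space M \<Longrightarrow> \<rho> \<omega> = T"
  shows "AE \<omega> in M. E T (\<lambda>\<omega>. U (\<rho> \<omega>) T \<omega>) \<omega> = U T T \<omega>"
proof -
  have UT: "integrable M (U T T)" "U T T \<in> borel_measurable (F T)"
    using U_int[of T T] U_meas[of T T] by auto
  have "integrable M (\<lambda>\<omega>. U (\<rho> \<omega>) T \<omega>) \<longleftrightarrow> integrable M (U T T)"
    by (rule Bochner_Integration.integrable_cong) (auto simp: \<rho>)
  then have "AE \<omega> in M. \<omega> \<in> space M \<longrightarrow> E T (\<lambda>\<omega>. U (\<rho> \<omega>) T \<omega>) \<omega> = U T T \<omega>"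
    using UT sets.top[of "F T"] by (intro E_local_known) (auto simp: \<rho>)
  then show ?thesis using AE_space by eventually_elim simp
qed

lemma V1_end: "AE \<omega> in M. V1 M F T U T \<omega> = U T T \<omega>"
proof -
  obtain \<rho> where \<rho>: "\<rho> \<in> stops T"
    and eq: "AE \<omega> in M. E T (\<lambda>\<omega>. U (\<rho> \<omega>) T \<omega>) \<omega> = V1 M F T U T \<omega>"
    using V1_attained[of T] by auto
  have "AE \<omega> in M. E T (\<lambda>\<omega>. U (\<rho> \<omega>) T \<omega>) \<omega> = U T T \<omega>"
    by (rule E_U_at_end) (use stops_range[OF \<rho>] in force)
  with eq show ?thesis by eventually_elim simp
qed

lemma V1_le_V2:
  assumes "t \<le> T"
  shows "AE \<omega> in M. V1 M F T U t \<omega> \<le> V2 M F T U t \<omega>"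
proof (cases "t = T")
  case True
  from V1_end show ?thesis unfolding True by eventually_elim (simp add: V2_def)
qed (use assms in \<open>simp add: V2_def\<close>)

lemma V2_eq: "V2 M F T U t = (if t < T then (\<lambda>\<omega>. max (V2_pre M F T U t \<omega>) (V1 M F T U t \<omega>)) else U T T)"
  by (auto simp: V2_def)

lemma V2_meas: "t \<le> T \<Longrightarrow> V2 M F T U t \<in> borel_measurable (F t)"
  using V1_meas[of t] V2_pre_meas[of t] U_meas[of T T]
  by (cases "t = T") (auto simp: V2_eq intro!: borel_measurable_max)

lemma V2_int: "t \<le> T \<Longrightarrow> integrable M (V2 M F T U t)"
  using V1_int[of t] V2_pre_int[of t] U_int[of T T]
  by (cases "t = T") (auto simp: V2_eq intro!: Bochner_Integration.integrable_max)

end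

sublocale stopping_game \<subseteq> dynkin_game M F T "V1 M F T U" "V2 M F T U"
  by unfold_locales (auto intro: V1_meas V2_meas V1_int V2_int V1_le_V2)

section \<open>The saddle point of the Dynkin game\<close>

context stopping_game
begin

abbreviation \<rho>d :: "'a \<Rightarrow> nat" where "\<rho>d \<equiv> rho_d M F T U"
abbreviation \<tau>d :: "'a \<Rightarrow> nat" where "\<tau>d \<equiv> tau_d M F T U"
abbreviation D :: "nat \<Rightarrow> 'a \<Rightarrow> real" where "D \<equiv> dynkin_process M F T U"

lemma reward_eq: "reward \<rho> \<tau> = dynkin_payoff M F T U \<rho> \<tau>"
  by (auto simp: reward_def dynkin_payoff_def)

lemma D_eq_v:
  assumes "t \<le> T"
  shows "D t \<in> borel_measurable (F t)" "AE \<omega> in M. D t \<omega> = v t \<omega>"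
proof -
  show eq: "AE \<omega> in M. D t \<omega> = v t \<omega>"
    using value_process(2)[OF assms] by (simp add: dynkin_process_def reward_eq)
  show "D t \<in> borel_measurable (F t)"
    by (rule measurable_F_AE[OF v_meas[OF assms] _ assms])
      (use eq value_process(1)[OF assms] in \<open>auto simp: dynkin_process_def reward_eq\<close>)
qed

lemma \<rho>d_first_hit: "\<rho>d = first_hit (\<lambda>s \<omega>. D s \<omega> = V2 M F T U s \<omega>) T 0"
  by (rule ext) (simp add: rho_d_def first_hit_def)

lemma \<tau>d_first_hit: "\<tau>d = first_hit (\<lambda>s \<omega>. D s \<omega> = V1 M F T U s \<omega>) T 0"
  by (rule ext) (simp add: tau_d_def first_hit_def)

lemma \<rho>d_in_stops: "\<rho>d \<in> stops 0"
  unfolding \<rho>d_first_hit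
proof (rule first_hit_in_stops)
  fix s assume "s < T"
  then have [measurable]: "D s \<in> borel_measurable (F s)" "V2 M F T U s \<in> borel_measurable (F s)"
    using D_eq_v(1)[of s] V2_meas[of s] by auto
  show "Measurable.pred (F s) (\<lambda>\<omega>. D s \<omega> = V2 M F T U s \<omega>)" by measurable
qed simp

lemma \<tau>d_in_stops: "\<tau>d \<in> stops 0"
  unfolding \<tau>d_first_hit
proof (rule first_hit_in_stops)
  fix s assume "s < T"
  then have [measurable]: "D s \<in> borel_measurable (F s)" "V1 M F T U s \<in> borel_measurable (F s)"
    using D_eq_v(1)[of s] V1_meas[of s] by auto
  show "Measurable.pred (F s) (\<lambda>\<omega>. D s \<omega> = V1 M F T U s \<omega>)" by measurable
qed simp

lemma AE_D_eq_v: "AE \<omega> in M. \<forall>s\<in>{..T}. D s \<omega> = v s \<omega>"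
  unfolding AE_finite_all[OF finite_atMost] using D_eq_v(2) by auto

lemma \<rho>d_opt: "AE \<omega> in M. \<rho>d \<omega> = \<rho>_opt 0 \<omega>"
  using AE_D_eq_v unfolding \<rho>d_first_hit \<rho>_opt_def
  by eventually_elim (rule first_hit_cong, auto)

lemma \<tau>d_opt: "AE \<omega> in M. \<tau>d \<omega> = \<tau>_opt 0 \<omega>"
  using AE_D_eq_v unfolding \<tau>d_first_hit \<tau>_opt_def
  by eventually_elim (rule first_hit_cong, auto)

lemma dynkin_value_eq: "dynkin_value M F T U = (\<integral>\<omega>. v 0 \<omega> \<partial>M)"
  using inf_sup_value by (simp add: dynkin_value_def reward_eq)

lemma saddle_\<rho>d:
  assumes "\<tau> \<in> stops 0"
  shows "(\<integral>\<omega>. reward \<rho>d \<tau> \<omega> \<partial>M) \<le> dynkin_value M F T U"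
proof -
  have "(\<integral>\<omega>. reward \<rho>d \<tau> \<omega> \<partial>M) = (\<integral>\<omega>. reward (\<rho>_opt 0) \<tau> \<omega> \<partial>M)"
  proof (rule integral_cong_AE)
    show "AE \<omega> in M. reward \<rho>d \<tau> \<omega> = reward (\<rho>_opt 0) \<tau> \<omega>"
      using \<rho>d_opt by eventually_elim (simp add: reward_def)
  qed (use reward_int[OF _ assms] \<rho>d_in_stops \<rho>_opt_in_stops[of 0] in auto)
  then show ?thesis using saddle_point(1)[OF assms] dynkin_value_eq by simp
qed

lemma saddle_\<tau>d:
  assumes "\<rho> \<in> stops 0"
  shows "dynkin_value M F T U \<le> (\<integral>\<omega>. reward \<rho> \<tau>d \<omega> \<partial>M)"
proof -
  have "(\<integral>\<omega>. reward \<rho> \<tau>d \<omega> \<partial>M) = (\<integral>\<omega>. reward \<rho> (\<tau>_opt 0) \<omega> \<partial>M)"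
  proof (rule integral_cong_AE)
    show "AE \<omega> in M. reward \<rho> \<tau>d \<omega> = reward \<rho> (\<tau>_opt 0) \<omega>"
      using \<tau>d_opt by eventually_elim (simp add: reward_def)
  qed (use reward_int[OF assms] \<tau>d_in_stops \<tau>_opt_in_stops[of 0] in auto)
  then show ?thesis using saddle_point(2)[OF assms] dynkin_value_eq by simp
qed

text \<open>
  Strictly before \<open>\<tau>d\<close> the value exceeds \<open>V1\<close>. Since it is at most \<open>V2\<close>, the maximum that defines
  \<open>V2\<close> is not \<open>V1\<close>: if the minimiser stops here, the maximiser can really obtain \<open>V2\<close>.
\<close>

lemma V2_before_\<tau>d:
  "AE \<omega> in M. \<forall>k<T. k < \<tau>d \<omega> \<longrightarrow> V2 M F T U k \<omega> = V2_pre M F T U k \<omega>"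
proof -
  have "AE \<omega> in M. \<forall>k\<in>{..T}. V1 M F T U k \<omega> \<le> v k \<omega> \<and> v k \<omega> \<le> V2 M F T U k \<omega>"
    unfolding AE_finite_all[OF finite_atMost] using A_le_v v_le_B by auto
  with AE_D_eq_v show ?thesis
  proof eventually_elim
    case (elim \<omega>)
    show ?case
    proof (intro allI impI)
      fix k assume k: "k < T" "k < \<tau>d \<omega>"
      then have "D k \<omega> \<noteq> V1 M F T U k \<omega>"
        unfolding \<tau>d_first_hit using first_hit_before[of 0 k _ T \<omega>] by blast
      moreover have "D k \<omega> = v k \<omega>" "V1 M F T U k \<omega> \<le> v k \<omega>" "v k \<omega> \<le> V2 M F T U k \<omega>"
        using elim k by auto
      ultimately have "V1 M F T U k \<omega> < V2 M F T U k \<omega>" by linarith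
      then show "V2 M F T U k \<omega> = V2_pre M F T U k \<omega>" using k by (auto simp: V2_def max_def split: if_splits)
    qed
  qed
qed

end

section \<open>Comparing the two games\<close>

context stopping_game
begin

lemma payoff_bounded: "\<exists>C. \<forall>\<rho>\<in>stops 0. \<forall>\<tau>\<in>stops 0. \<bar>payoff M U \<rho> \<tau>\<bar> \<le> C"
proof -
  obtain C where C: "\<forall>s\<le>T. \<forall>t\<le>T. \<forall>\<omega>\<in>space M. \<bar>U s t \<omega>\<bar> \<le> C" using U_bdd by blast
  have "\<bar>payoff M U \<rho> \<tau>\<bar> \<le> C" if s: "\<rho> \<in> stops 0" "\<tau> \<in> stops 0" for \<rho> \<tau>
  proof -
    have "\<bar>payoff M U \<rho> \<tau>\<bar> \<le> (\<integral>\<omega>. \<bar>U (\<rho> \<omega>) (\<tau> \<omega>) \<omega>\<bar> \<partial>M)"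
      unfolding payoff_def by (rule integral_abs_bound)
    also have "\<dots> \<le> (\<integral>\<omega>. C \<partial>M)"
      by (rule integral_mono)
        (use U_stopped_int[OF s] C stops_range[OF s(1)] stops_range[OF s(2)] in auto)
    finally show ?thesis by (simp add: prob_space)
  qed
  then show ?thesis by blast
qed

lemma rho_u_properties:
  assumes u: "is_rho_u M F T U \<rho>u" and k: "k \<le> T"
  shows "\<rho>u k \<in> stops k" "AE \<omega> in M. E k (\<lambda>\<omega>. U (\<rho>u k \<omega>) k \<omega>) \<omega> = V1 M F T U k \<omega>"
proof -
  have fin: "\<rho>u T \<omega> = T" if "\<omega> \<in> space M" for \<omega> using u that by (simp add: is_rho_u_def)
  have "\<rho>u T \<in> stops T"
  proof (rule stopsI)
    fix k assume "k \<le> T"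
    have "Measurable.pred (F k) (\<lambda>\<omega>. T = k)" by simp
    moreover have "T = k \<longleftrightarrow> \<rho>u T \<omega> = k" if "\<omega> \<in> space (F k)" for \<omega> using fin that by simp
    ultimately show "Measurable.pred (F k) (\<lambda>\<omega>. \<rho>u T \<omega> = k)" by (subst measurable_cong[symmetric])
  qed (simp_all add: fin)
  then show "\<rho>u k \<in> stops k" using u k by (cases "k = T") (auto simp: is_rho_u_def)
  have "AE \<omega> in M. E T (\<lambda>\<omega>. U (\<rho>u T \<omega>) T \<omega>) \<omega> = U T T \<omega>"
    by (rule E_U_at_end) (rule fin)
  with V1_end have "AE \<omega> in M. E T (\<lambda>\<omega>. U (\<rho>u T \<omega>) T \<omega>) \<omega> = V1 M F T U T \<omega>"
    by eventually_elim simp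
  then show "AE \<omega> in M. E k (\<lambda>\<omega>. U (\<rho>u k \<omega>) k \<omega>) \<omega> = V1 M F T U k \<omega>"
    using u k by (cases "k = T") (auto simp: is_rho_u_def)
qed

lemma tau_u_properties:
  assumes "is_tau_u M F T U \<tau>u" "k < T"
  shows "\<tau>u k \<in> stops (Suc k)" "AE \<omega> in M. E k (\<lambda>\<omega>. U k (\<tau>u k \<omega>) \<omega>) \<omega> = V2_pre M F T U k \<omega>"
  using assms by (auto simp: is_tau_u_def)

text \<open>
  The label \<open>\<kappa>\<close> records who stops first, ties counting for \<open>a\<close>, and when. It is known at that time.
\<close>

lemma first_stopper_pieces:
  assumes a: "a \<in> stops 0" and b: "b \<in> stops 0"
  defines "\<kappa> \<equiv> \<lambda>\<omega>. (a \<omega> \<le> b \<omega>, min (a \<omega>) (b \<omega>))"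
  shows "\<And>\<omega>. \<omega> \<in> space M \<Longrightarrow> \<kappa> \<omega> \<in> UNIV \<times> {..T}"
    and "\<And>i. i \<in> UNIV \<times> {..T} \<Longrightarrow> {\<omega>\<in>space M. \<kappa> \<omega> = i} \<in> sets (F (snd i))"
proof -
  show "\<kappa> \<omega> \<in> UNIV \<times> {..T}" if "\<omega> \<in> space M" for \<omega>
    using stops_range[OF a that] by (auto simp: \<kappa>_def)
  fix i :: "bool \<times> nat"
  obtain c k where i: "i = (c, k)" by force
  have [measurable]: "Measurable.pred (F k) (\<lambda>\<omega>. a \<omega> = k)" "Measurable.pred (F k) (\<lambda>\<omega>. b \<omega> = k)"
    "Measurable.pred (F k) (\<lambda>\<omega>. k \<le> b \<omega>)" "Measurable.pred (F k) (\<lambda>\<omega>. k < a \<omega>)"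
    using stops_pred_eq[OF a, of k k] stops_pred_eq[OF b, of k k]
      stops_pred_ge[OF b, of k k] stops_pred_gt[OF a, of k k] by auto
  have "Measurable.pred (F k) (\<lambda>\<omega>. if c then a \<omega> = k \<and> k \<le> b \<omega> else b \<omega> = k \<and> k < a \<omega>)"
    by (cases c) simp_all
  also have "(\<lambda>\<omega>. if c then a \<omega> = k \<and> k \<le> b \<omega> else b \<omega> = k \<and> k < a \<omega>) = (\<lambda>\<omega>. \<kappa> \<omega> = i)"
    by (auto simp: \<kappa>_def i)
  finally show "{\<omega>\<in>space M. \<kappa> \<omega> = i} \<in> sets (F (snd i))"
    using set_of_pred i by simp
qed

text \<open>
  Here \<open>\<rho>'\<close> and \<open>\<tau>'\<close> are the final stopping times, and \<open>\<tau>\<close> is the time at which the maximiser stops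
  as long as the minimiser keeps to \<open>\<rho>d\<close>. Condition at the first of \<open>\<tau>\<close> and \<open>\<rho>d\<close>, at time \<open>k\<close>. If \<open>\<tau>\<close> comes first, the minimiser
  plays \<open>\<rho>u k\<close> and the conditional payoff is \<open>V1 k\<close>. Otherwise the minimiser stops at \<open>k\<close>, the
  maximiser later, and the conditional payoff is at most \<open>V2 k\<close>. In both cases it is bounded by
  the reward of \<open>(\<rho>d, \<tau>)\<close> in the Dynkin game.
\<close>

lemma payoff_upper_estimate:
  assumes u: "is_rho_u M F T U \<rho>u"
    and stops: "\<rho>' \<in> stops 0" "\<tau>' \<in> stops 0" "\<tau> \<in> stops 0"
    and after: "AE \<omega> in M. \<rho>d \<omega> < \<tau> \<omega> \<longrightarrow> \<rho>' \<omega> = \<rho>d \<omega> \<and> \<rho>d \<omega> < \<tau>' \<omega>"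
    and before: "AE \<omega> in M. \<tau> \<omega> \<le> \<rho>d \<omega> \<longrightarrow> \<tau>' \<omega> = \<tau> \<omega> \<and> \<rho>' \<omega> = \<rho>u (\<tau> \<omega>) \<omega>"
  shows "payoff M U \<rho>' \<tau>' \<le> dynkin_value M F T U"
proof -
  define X where "X = (\<lambda>\<omega>. U (\<rho>' \<omega>) (\<tau>' \<omega>) \<omega>)"
  define \<kappa> where "\<kappa> = (\<lambda>\<omega>. (\<tau> \<omega> \<le> \<rho>d \<omega>, min (\<tau> \<omega>) (\<rho>d \<omega>)))"
  have X: "integrable M X" unfolding X_def by (rule U_stopped_int[OF stops(1,2)])
  have I: "finite (UNIV \<times> {..T} :: (bool \<times> nat) set)" by simp
  have \<kappa>: "\<And>\<omega>. \<omega> \<in> space M \<Longrightarrow> \<kappa> \<omega> \<in> UNIV \<times> {..T}"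
    "\<And>i. i \<in> UNIV \<times> {..T} \<Longrightarrow> {\<omega>\<in>space M. \<kappa> \<omega> = i} \<in> sets (F (snd i))"
    unfolding \<kappa>_def by (erule first_stopper_pieces[OF stops(3) \<rho>d_in_stops])+
  have time: "snd i \<le> T" if "i \<in> UNIV \<times> {..T}" for i :: "bool \<times> nat" using that by auto
  have "AE \<omega> in M. E (snd (\<kappa> \<omega>)) X \<omega> \<le> reward \<rho>d \<tau> \<omega>"
  proof (rule AE_pieces[OF I \<kappa>(1)])
    fix i :: "bool \<times> nat" assume iI: "i \<in> UNIV \<times> {..T}"
    then obtain c k where i: "i = (c, k)" and k: "k \<le> T" by auto
    have C: "{\<omega>\<in>space M. \<kappa> \<omega> = i} \<in> sets (F k)" using \<kappa>(2)[OF iI] by (simp only: i snd_conv)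
    show "AE \<omega> in M. \<kappa> \<omega> = i \<longrightarrow> E (snd i) X \<omega> \<le> reward \<rho>d \<tau> \<omega>"
    proof (cases c)
      case True
      have "AE \<omega> in M. \<omega> \<in> {\<omega>\<in>space M. \<kappa> \<omega> = i} \<longrightarrow> E k X \<omega> = E k (\<lambda>\<omega>. U (\<rho>u k \<omega>) k \<omega>) \<omega>"
      proof (rule E_local_cong[OF C k X U_stopped_int1[OF k rho_u_properties(1)[OF u k]]])
        show "AE \<omega> in M. \<omega> \<in> {\<omega>\<in>space M. \<kappa> \<omega> = i} \<longrightarrow> X \<omega> = U (\<rho>u k \<omega>) k \<omega>"
          using before by eventually_elim (auto simp: X_def \<kappa>_def i True)
      qed
      with rho_u_properties(2)[OF u k] AE_space show ?thesis
        by eventually_elim (auto simp: \<kappa>_def i True reward_def)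
    next
      case False
      show ?thesis
      proof (cases "k = T")
        case True
        \<comment> \<open>this piece is empty: nobody stops strictly after the horizon\<close>
        show ?thesis
          using AE_space by eventually_elim
            (use stops_range[OF stops(3)] in \<open>force simp: \<kappa>_def i \<open>\<not> c\<close> \<open>k = T\<close> min_def split: if_splits\<close>)
      next
        case kT: False
        then have k': "k < T" using k by simp
        \<comment> \<open>on this piece the maximum changes nothing, but it makes the time admissible everywhere\<close>
        have \<tau>2: "(\<lambda>\<omega>. max (\<tau>' \<omega>) (Suc k)) \<in> stops (Suc k)"
          using max_in_stops[OF stops(2)] k' by auto
        have "AE \<omega> in M. \<omega> \<in> {\<omega>\<in>space M. \<kappa> \<omega> = i} \<longrightarrow>
            E k X \<omega> = E k (\<lambda>\<omega>. U k (max (\<tau>' \<omega>) (Suc k)) \<omega>) \<omega>"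
        proof (rule E_local_cong[OF C k X U_stopped_int2[OF k \<tau>2]])
          show "AE \<omega> in M. \<omega> \<in> {\<omega>\<in>space M. \<kappa> \<omega> = i} \<longrightarrow> X \<omega> = U k (max (\<tau>' \<omega>) (Suc k)) \<omega>"
            using after by eventually_elim (auto simp: X_def \<kappa>_def i False max_absorb1)
        qed
        with V2_pre_ge[OF k' \<tau>2] AE_space show ?thesis
          by eventually_elim (use k' in \<open>auto simp: \<kappa>_def i False reward_def V2_def\<close>)
      qed
    qed
  qed
  then have "(\<integral>\<omega>. E (snd (\<kappa> \<omega>)) X \<omega> \<partial>M) \<le> (\<integral>\<omega>. reward \<rho>d \<tau> \<omega> \<partial>M)"
    by (intro integral_mono_AE integral_E_pieces(1)[OF I \<kappa>(1) X \<kappa>(2) time]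
        reward_int[OF \<rho>d_in_stops stops(3)])
  also have "\<dots> \<le> dynkin_value M F T U" by (rule saddle_\<rho>d[OF stops(3)])
  also have "(\<integral>\<omega>. E (snd (\<kappa> \<omega>)) X \<omega> \<partial>M) = payoff M U \<rho>' \<tau>'"
    using integral_E_pieces(2)[OF I \<kappa>(1) X \<kappa>(2) time] by (simp add: payoff_def X_def)
  finally show ?thesis .
qed

text \<open>
  Conditioning at the first of \<open>\<tau>d\<close> and \<open>\<rho>\<close>, the conditional payoff is at least \<open>V1 k\<close> if the maximiser stops
  at \<open>k = \<tau>d\<close>, and is \<open>V2_pre k\<close> if the minimiser stops at \<open>k < \<tau>d\<close>. In the latter case
  \<open>V2_pre k = V2 k\<close> by \<open>V2_before_\<tau>d\<close>, so the reward of \<open>(\<rho>, \<tau>d)\<close> in the Dynkin game is a lower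
  bound.
\<close>

lemma payoff_lower_estimate:
  assumes u: "is_tau_u M F T U \<tau>u"
    and stops: "\<rho>' \<in> stops 0" "\<tau>' \<in> stops 0" "\<rho> \<in> stops 0"
    and before: "AE \<omega> in M. \<tau>d \<omega> \<le> \<rho> \<omega> \<longrightarrow> \<tau>' \<omega> = \<tau>d \<omega> \<and> \<tau>d \<omega> \<le> \<rho>' \<omega>"
    and after: "AE \<omega> in M. \<rho> \<omega> < \<tau>d \<omega> \<longrightarrow> \<rho>' \<omega> = \<rho> \<omega> \<and> \<tau>' \<omega> = \<tau>u (\<rho> \<omega>) \<omega>"
  shows "dynkin_value M F T U \<le> payoff M U \<rho>' \<tau>'"
proof -
  define X where "X = (\<lambda>\<omega>. U (\<rho>' \<omega>) (\<tau>' \<omega>) \<omega>)"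
  define \<kappa> where "\<kappa> = (\<lambda>\<omega>. (\<tau>d \<omega> \<le> \<rho> \<omega>, min (\<tau>d \<omega>) (\<rho> \<omega>)))"
  have X: "integrable M X" unfolding X_def by (rule U_stopped_int[OF stops(1,2)])
  have I: "finite (UNIV \<times> {..T} :: (bool \<times> nat) set)" by simp
  have \<kappa>: "\<And>\<omega>. \<omega> \<in> space M \<Longrightarrow> \<kappa> \<omega> \<in> UNIV \<times> {..T}"
    "\<And>i. i \<in> UNIV \<times> {..T} \<Longrightarrow> {\<omega>\<in>space M. \<kappa> \<omega> = i} \<in> sets (F (snd i))"
    unfolding \<kappa>_def by (erule first_stopper_pieces[OF \<tau>d_in_stops stops(3)])+
  have time: "snd i \<le> T" if "i \<in> UNIV \<times> {..T}" for i :: "bool \<times> nat" using that by auto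
  have "AE \<omega> in M. reward \<rho> \<tau>d \<omega> \<le> E (snd (\<kappa> \<omega>)) X \<omega>"
  proof (rule AE_pieces[OF I \<kappa>(1)])
    fix i :: "bool \<times> nat" assume iI: "i \<in> UNIV \<times> {..T}"
    then obtain c k where i: "i = (c, k)" and k: "k \<le> T" by auto
    have C: "{\<omega>\<in>space M. \<kappa> \<omega> = i} \<in> sets (F k)" using \<kappa>(2)[OF iI] by (simp only: i snd_conv)
    show "AE \<omega> in M. \<kappa> \<omega> = i \<longrightarrow> reward \<rho> \<tau>d \<omega> \<le> E (snd i) X \<omega>"
    proof (cases c)
      case True
      have \<rho>2: "(\<lambda>\<omega>. max (\<rho>' \<omega>) k) \<in> stops k" by (rule max_in_stops[OF stops(1) k])
      have "AE \<omega> in M. \<omega> \<in> {\<omega>\<in>space M. \<kappa> \<omega> = i} \<longrightarrow> E k X \<omega> = E k (\<lambda>\<omega>. U (max (\<rho>' \<omega>) k) k \<omega>) \<omega>"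
      proof (rule E_local_cong[OF C k X U_stopped_int1[OF k \<rho>2]])
        show "AE \<omega> in M. \<omega> \<in> {\<omega>\<in>space M. \<kappa> \<omega> = i} \<longrightarrow> X \<omega> = U (max (\<rho>' \<omega>) k) k \<omega>"
          using before by eventually_elim (auto simp: X_def \<kappa>_def i True max_absorb1)
      qed
      with V1_le[OF k \<rho>2] AE_space show ?thesis
        by eventually_elim (auto simp: \<kappa>_def i True reward_def)
    next
      case False
      show ?thesis
      proof (cases "k = T")
        case True
        \<comment> \<open>this piece is empty: nobody stops strictly after the horizon\<close>
        show ?thesis
          using AE_space by eventually_elim
            (use stops_range[OF \<tau>d_in_stops] in \<open>force simp: \<kappa>_def i \<open>\<not> c\<close> \<open>k = T\<close> min_def split: if_splits\<close>)
      next
        case kT: False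
        then have k': "k < T" using k by simp
        have "AE \<omega> in M. \<omega> \<in> {\<omega>\<in>space M. \<kappa> \<omega> = i} \<longrightarrow> E k X \<omega> = E k (\<lambda>\<omega>. U k (\<tau>u k \<omega>) \<omega>) \<omega>"
        proof (rule E_local_cong[OF C k X U_stopped_int2[OF k tau_u_properties(1)[OF u k']]])
          show "AE \<omega> in M. \<omega> \<in> {\<omega>\<in>space M. \<kappa> \<omega> = i} \<longrightarrow> X \<omega> = U k (\<tau>u k \<omega>) \<omega>"
            using after by eventually_elim (auto simp: X_def \<kappa>_def i False)
        qed
        with tau_u_properties(2)[OF u k'] V2_before_\<tau>d AE_space show ?thesis
          by eventually_elim (use k' in \<open>auto simp: \<kappa>_def i False reward_def\<close>)
      qed
    qed
  qed
  then have "(\<integral>\<omega>. reward \<rho> \<tau>d \<omega> \<partial>M) \<le> (\<integral>\<omega>. E (snd (\<kappa> \<omega>)) X \<omega> \<partial>M)"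
    by (intro integral_mono_AE integral_E_pieces(1)[OF I \<kappa>(1) X \<kappa>(2) time]
        reward_int[OF stops(3) \<tau>d_in_stops])
  moreover have "dynkin_value M F T U \<le> (\<integral>\<omega>. reward \<rho> \<tau>d \<omega> \<partial>M)" by (rule saddle_\<tau>d[OF stops(3)])
  moreover have "(\<integral>\<omega>. E (snd (\<kappa> \<omega>)) X \<omega> \<partial>M) = payoff M U \<rho>' \<tau>'"
    using integral_E_pieces(2)[OF I \<kappa>(1) X \<kappa>(2) time] by (simp add: payoff_def X_def)
  ultimately show ?thesis by simp
qed

end

section \<open>Values determined by one strategy and one reply map\<close>

text \<open>
  One choice \<open>r0\<close> that holds the payoff down to \<open>v\<close> against everything, and a reply to every choice
  that pushes it up to \<open>v\<close>, determine the inf-sup value and make both witnesses optimal.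
\<close>

lemma minimax_witnesses:
  fixes K :: "'r \<Rightarrow> 's \<Rightarrow> real"
  assumes bdd: "\<And>r s. r \<in> R \<Longrightarrow> s \<in> S \<Longrightarrow> \<bar>K r s\<bar> \<le> C"
    and r0: "r0 \<in> R" "\<And>s. s \<in> S \<Longrightarrow> K r0 s \<le> v"
    and reply: "\<And>r. r \<in> R \<Longrightarrow> f r \<in> S" "\<And>r. r \<in> R \<Longrightarrow> v \<le> K r (f r)"
  shows "(INF r\<in>R. SUP s\<in>S. K r s) = v" "(SUP s\<in>S. K r0 s) = v" "(INF r\<in>R. K r (f r)) = v"
proof -
  have S: "S \<noteq> {}" using reply(1)[OF r0(1)] by auto
  have above: "bdd_above (K r ` S)" if "r \<in> R" for r
    using bdd[OF that] by (intro bdd_aboveI2[of _ _ C]) (auto simp: abs_le_iff)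
  have ge: "v \<le> (SUP s\<in>S. K r s)" if "r \<in> R" for r
    using reply(2)[OF that] by (rule order_trans) (rule cSUP_upper[OF reply(1)[OF that] above[OF that]])
  show sup: "(SUP s\<in>S. K r0 s) = v"
    using ge[OF r0(1)] cSUP_least[OF S r0(2)] by (intro antisym) auto
  have "(INF r\<in>R. SUP s\<in>S. K r s) \<le> (SUP s\<in>S. K r0 s)"
    using ge by (intro cINF_lower[OF _ r0(1)] bdd_belowI2)
  then show "(INF r\<in>R. SUP s\<in>S. K r s) = v"
    using r0(1) ge unfolding sup by (intro antisym cINF_greatest) auto
  have "(INF r\<in>R. K r (f r)) \<le> K r0 (f r0)"
    using reply(2) by (intro cINF_lower[OF _ r0(1)] bdd_belowI2)
  also have "\<dots> \<le> v" by (rule r0(2)[OF reply(1)[OF r0(1)]])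
  finally show "(INF r\<in>R. K r (f r)) = v"
    using r0(1) reply(2) by (intro antisym cINF_greatest) auto
qed

lemma maximin_witnesses:
  fixes K :: "'r \<Rightarrow> 's \<Rightarrow> real"
  assumes bdd: "\<And>r s. r \<in> R \<Longrightarrow> s \<in> S \<Longrightarrow> \<bar>K r s\<bar> \<le> C"
    and r0: "r0 \<in> R" "\<And>s. s \<in> S \<Longrightarrow> v \<le> K r0 s"
    and reply: "\<And>r. r \<in> R \<Longrightarrow> f r \<in> S" "\<And>r. r \<in> R \<Longrightarrow> K r (f r) \<le> v"
  shows "(SUP r\<in>R. INF s\<in>S. K r s) = v" "(INF s\<in>S. K r0 s) = v" "(SUP r\<in>R. K r (f r)) = v"
proof -
  have S: "S \<noteq> {}" using reply(1)[OF r0(1)] by auto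
  have below: "bdd_below (K r ` S)" if "r \<in> R" for r
    using bdd[OF that] by (intro bdd_belowI2[of _ "- C"]) (auto simp: abs_le_iff minus_le_iff)
  have le: "(INF s\<in>S. K r s) \<le> v" if "r \<in> R" for r
    using cINF_lower[OF below[OF that] reply(1)[OF that]] reply(2)[OF that] by (rule order_trans)
  show inf: "(INF s\<in>S. K r0 s) = v"
    using le[OF r0(1)] cINF_greatest[OF S r0(2)] by (intro antisym) auto
  have "(INF s\<in>S. K r0 s) \<le> (SUP r\<in>R. INF s\<in>S. K r s)"
    using le by (intro cSUP_upper[OF r0(1)] bdd_aboveI2)
  then show "(SUP r\<in>R. INF s\<in>S. K r s) = v"
    using r0(1) le unfolding inf by (intro antisym cSUP_least) auto
  have "v \<le> K r0 (f r0)" by (rule r0(2)[OF reply(1)[OF r0(1)]])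
  also have "\<dots> \<le> (SUP r\<in>R. K r (f r))"
    using reply(2) by (intro cSUP_upper[OF r0(1)] bdd_aboveI2)
  finally show "(SUP r\<in>R. K r (f r)) = v"
    using r0(1) reply(2) by (intro antisym cSUP_least) auto
qed

section \<open>The optimal strategies and replies\<close>

context stopping_game
begin

abbreviation "SI \<equiv> strategies_I M F T"
abbreviation "SII \<equiv> strategies_II M F T"

lemma tau_u_in_stops: "is_tau_u M F T U \<tau>u \<Longrightarrow> k < T \<Longrightarrow> \<tau>u k \<in> stops k"
  using tau_u_properties(1)[of \<tau>u k] stops_mono[of k "Suc k"] by auto

lemma rho_u_ge:
  assumes "is_rho_u M F T U \<rho>u" "\<sigma> \<in> stops 0" "\<omega> \<in> space M"
  shows "\<sigma> \<omega> \<le> \<rho>u (\<sigma> \<omega>) \<omega>"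
  using stops_range[OF rho_u_properties(1)[OF assms(1)] assms(3), of "\<sigma> \<omega>"] stops_range[OF assms(2,3)] by simp

lemma tau_u_gt:
  assumes "is_tau_u M F T U \<tau>u" "k < T" "\<omega> \<in> space M"
  shows "k < \<tau>u k \<omega>"
  using stops_range[OF tau_u_properties(1)[OF assms(1,2)] assms(3)] by simp

lemma rho_star_in_stops:
  assumes "is_rho_u M F T U \<rho>u" "\<tau> \<in> stops 0"
  shows "rho_star M F T U \<rho>u \<tau> \<in> stops 0"
  using paste_after_less_in_stops[OF \<rho>d_in_stops assms(2) rho_u_properties(1)[OF assms(1)]]
  by (simp add: rho_star_def[abs_def])

lemma tau_star2_in_stops:
  assumes "is_tau_u M F T U \<tau>u" "\<rho> \<in> stops 0"
  shows "tau_star2 M F T U \<tau>u \<rho> \<in> stops 0"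
  using paste_after_le_in_stops[OF \<tau>d_in_stops assms(2) tau_u_in_stops[OF assms(1)]]
  by (simp add: tau_star2_def[abs_def])

text \<open>
  If both times exceed \<open>\<rho>d\<close>, the reaction is the common earlier time \<open>\<rho>d\<close>. Otherwise the smaller
  of the two is at most \<open>\<rho>d\<close>, and both reactions are at least as large, by \<open>\<rho>u k \<ge> k\<close>.
\<close>

lemma rho_star_strategy:
  assumes u: "is_rho_u M F T U \<rho>u"
  shows "rho_star M F T U \<rho>u \<in> SII"
  unfolding strategies_II_def
proof (intro CollectI conjI Pi_I ballI AE_I2)
  fix \<sigma>1 \<sigma>2 \<omega>
  assume s: "\<sigma>1 \<in> stops 0" "\<sigma>2 \<in> stops 0" and \<omega>: "\<omega> \<in> space M"
  show "(rho_star M F T U \<rho>u \<sigma>1 \<omega> = rho_star M F T U \<rho>u \<sigma>2 \<omega> \<and>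
      rho_star M F T U \<rho>u \<sigma>1 \<omega> < min (\<sigma>1 \<omega>) (\<sigma>2 \<omega>)) \<or>
    min (\<sigma>1 \<omega>) (\<sigma>2 \<omega>) \<le> min (rho_star M F T U \<rho>u \<sigma>1 \<omega>) (rho_star M F T U \<rho>u \<sigma>2 \<omega>)"
    using rho_u_ge[OF u s(1) \<omega>] rho_u_ge[OF u s(2) \<omega>] by (auto simp: rho_star_def)
qed (rule rho_star_in_stops[OF u])

text \<open>
  Here \<open>\<tau>u k > k\<close> for \<open>k < T\<close> gives the strict inequality that type I demands.
\<close>

lemma tau_star2_strategy:
  assumes u: "is_tau_u M F T U \<tau>u"
  shows "tau_star2 M F T U \<tau>u \<in> SI"
  unfolding strategies_I_def
proof (intro CollectI conjI Pi_I ballI AE_I2)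
  fix \<sigma>1 \<sigma>2 \<omega>
  assume s: "\<sigma>1 \<in> stops 0" "\<sigma>2 \<in> stops 0" and \<omega>: "\<omega> \<in> space M"
  have gt: "\<sigma> \<omega> < \<tau>u (\<sigma> \<omega>) \<omega>" if "\<sigma> \<omega> < \<tau>d \<omega>" for \<sigma>
    using tau_u_gt[OF u _ \<omega>] stops_range[OF \<tau>d_in_stops \<omega>] that by auto
  show "(tau_star2 M F T U \<tau>u \<sigma>1 \<omega> = tau_star2 M F T U \<tau>u \<sigma>2 \<omega> \<and>
      tau_star2 M F T U \<tau>u \<sigma>1 \<omega> \<le> min (\<sigma>1 \<omega>) (\<sigma>2 \<omega>)) \<or>
    min (\<sigma>1 \<omega>) (\<sigma>2 \<omega>) < min (tau_star2 M F T U \<tau>u \<sigma>1 \<omega>) (tau_star2 M F T U \<tau>u \<sigma>2 \<omega>)"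
    using gt[of \<sigma>1] gt[of \<sigma>2] by (auto simp: tau_star2_def)
qed (rule tau_star2_in_stops[OF u])

lemma tau_star_in_stops:
  assumes "is_tau_u M F T U \<tau>u" "r \<in> SII"
  shows "tau_star M F T U \<tau>u r \<in> stops 0"
proof -
  have "r \<tau>d \<in> stops 0" using assms(2) \<tau>d_in_stops by (auto simp: strategies_II_def)
  from paste_after_le_in_stops[OF \<tau>d_in_stops this tau_u_in_stops[OF assms(1)]]
  show ?thesis by (simp add: tau_star_def[abs_def])
qed

lemma rho_star2_in_stops:
  assumes "is_rho_u M F T U \<rho>u" "s \<in> SI"
  shows "rho_star2 M F T U \<rho>u s \<in> stops 0"
proof -
  have "s \<rho>d \<in> stops 0" using assms(2) \<rho>d_in_stops by (auto simp: strategies_I_def)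
  from paste_after_less_in_stops[OF \<rho>d_in_stops this rho_u_properties(1)[OF assms(1)]]
  show ?thesis by (simp add: rho_star2_def[abs_def])
qed

lemma rho_star_payoff:
  assumes u: "is_rho_u M F T U \<rho>u" and \<tau>: "\<tau> \<in> stops 0"
  shows "payoff M U (rho_star M F T U \<rho>u \<tau>) \<tau> \<le> dynkin_value M F T U"
  by (rule payoff_upper_estimate[OF u rho_star_in_stops[OF u \<tau>] \<tau> \<tau>]) (simp_all add: rho_star_def)

lemma tau_star2_payoff:
  assumes u: "is_tau_u M F T U \<tau>u" and \<rho>: "\<rho> \<in> stops 0"
  shows "dynkin_value M F T U \<le> payoff M U \<rho> (tau_star2 M F T U \<tau>u \<rho>)"
  by (rule payoff_lower_estimate[OF u \<rho> tau_star2_in_stops[OF u \<rho>] \<rho>]) (simp_all add: tau_star2_def)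

text \<open>
  Apply the type II condition to \<open>\<tau>\<close> and \<open>\<tau>d\<close>. Where \<open>r \<tau>d < \<tau>d\<close>, the reply \<open>\<tau>\<close> is also later than
  \<open>r \<tau>d\<close>, so \<open>r\<close> has stopped before both and reacts alike. Where \<open>\<tau>d \<le> r \<tau>d\<close>, the reply is
  \<open>\<tau>d\<close>, and \<open>r\<close> does not stop before it.
\<close>

lemma tau_star_payoff:
  assumes u: "is_tau_u M F T U \<tau>u" and r: "r \<in> SII"
  defines "\<tau> \<equiv> tau_star M F T U \<tau>u r"
  shows "dynkin_value M F T U \<le> payoff M U (r \<tau>) \<tau>"
proof -
  have \<tau>: "\<tau> \<in> stops 0" unfolding \<tau>_def by (rule tau_star_in_stops[OF u r])
  have rs: "r \<tau> \<in> stops 0" "r \<tau>d \<in> stops 0"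
    using r \<tau> \<tau>d_in_stops by (auto simp: strategies_II_def)
  have "AE \<omega> in M. (r \<tau> \<omega> = r \<tau>d \<omega> \<and> r \<tau> \<omega> < min (\<tau> \<omega>) (\<tau>d \<omega>)) \<or>
      min (r \<tau> \<omega>) (r \<tau>d \<omega>) \<ge> min (\<tau> \<omega>) (\<tau>d \<omega>)"
    using r \<tau> \<tau>d_in_stops unfolding strategies_II_def by blast
  then have "AE \<omega> in M. (\<tau>d \<omega> \<le> r \<tau>d \<omega> \<longrightarrow> \<tau> \<omega> = \<tau>d \<omega> \<and> \<tau>d \<omega> \<le> r \<tau> \<omega>) \<and>
      (r \<tau>d \<omega> < \<tau>d \<omega> \<longrightarrow> r \<tau> \<omega> = r \<tau>d \<omega> \<and> \<tau> \<omega> = \<tau>u (r \<tau>d \<omega>) \<omega>)"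
    using AE_space
  proof eventually_elim
    case (elim \<omega>)
    have "r \<tau>d \<omega> < \<tau>u (r \<tau>d \<omega>) \<omega>" if "r \<tau>d \<omega> < \<tau>d \<omega>"
      using tau_u_gt[OF u _ elim(2)] stops_range[OF \<tau>d_in_stops elim(2)] that by auto
    then show ?case using elim(1) by (auto simp: \<tau>_def tau_star_def split: if_splits)
  qed
  then show ?thesis
    by (intro payoff_lower_estimate[OF u rs(1) \<tau> rs(2)]) (auto elim: eventually_mono)
qed

text \<open>
  Apply the type I condition to \<open>\<rho>\<close> and \<open>\<rho>d\<close>. Where \<open>s \<rho>d \<le> \<rho>d\<close>, the reply \<open>\<rho>\<close> is not earlier than
  \<open>s \<rho>d\<close>, so \<open>s\<close> has stopped no later than both and reacts alike. Where \<open>\<rho>d < s \<rho>d\<close>, the reply is \<open>\<rho>d\<close>,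
  and \<open>s\<close> stops strictly after it.
\<close>

lemma rho_star2_payoff:
  assumes u: "is_rho_u M F T U \<rho>u" and s: "s \<in> SI"
  defines "\<rho> \<equiv> rho_star2 M F T U \<rho>u s"
  shows "payoff M U \<rho> (s \<rho>) \<le> dynkin_value M F T U"
proof -
  have \<rho>: "\<rho> \<in> stops 0" unfolding \<rho>_def by (rule rho_star2_in_stops[OF u s])
  have ss: "s \<rho> \<in> stops 0" "s \<rho>d \<in> stops 0"
    using s \<rho> \<rho>d_in_stops by (auto simp: strategies_I_def)
  have "AE \<omega> in M. (s \<rho> \<omega> = s \<rho>d \<omega> \<and> s \<rho> \<omega> \<le> min (\<rho> \<omega>) (\<rho>d \<omega>)) \<or>
      min (s \<rho> \<omega>) (s \<rho>d \<omega>) > min (\<rho> \<omega>) (\<rho>d \<omega>)"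
    using s \<rho> \<rho>d_in_stops unfolding strategies_I_def by blast
  then have "AE \<omega> in M. (\<rho>d \<omega> < s \<rho>d \<omega> \<longrightarrow> \<rho> \<omega> = \<rho>d \<omega> \<and> \<rho>d \<omega> < s \<rho> \<omega>) \<and>
      (s \<rho>d \<omega> \<le> \<rho>d \<omega> \<longrightarrow> s \<rho> \<omega> = s \<rho>d \<omega> \<and> \<rho> \<omega> = \<rho>u (s \<rho>d \<omega>) \<omega>)"
    using AE_space
  proof eventually_elim
    case (elim \<omega>)
    show ?case using elim(1) rho_u_ge[OF u ss(2) elim(2)]
      by (auto simp: \<rho>_def rho_star2_def split: if_splits)
  qed
  then show ?thesis
    by (intro payoff_upper_estimate[OF u \<rho> ss(1,2)]) (auto elim: eventually_mono)
qed

lemma optimizers_ex: "(\<exists>\<rho>u. is_rho_u M F T U \<rho>u) \<and> (\<exists>\<tau>u. is_tau_u M F T U \<tau>u)"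
proof -
  obtain \<rho> where \<rho>: "\<And>t. t \<le> T \<Longrightarrow> \<rho> t \<in> stops t \<and>
      (AE \<omega> in M. E t (\<lambda>\<omega>. U (\<rho> t \<omega>) t \<omega>) \<omega> = V1 M F T U t \<omega>)"
    using V1_attained by metis
  obtain \<tau> where \<tau>: "\<And>t. t < T \<Longrightarrow> \<tau> t \<in> stops (Suc t) \<and>
      (AE \<omega> in M. E t (\<lambda>\<omega>. U t (\<tau> t \<omega>) \<omega>) \<omega> = V2_pre M F T U t \<omega>)"
    using V2_pre_attained by metis
  have "is_rho_u M F T U (\<lambda>t. if t < T then \<rho> t else (\<lambda>_. T))"
    using \<rho> by (simp add: is_rho_u_def)
  moreover have "is_tau_u M F T U (\<lambda>t. if t < T then \<tau> t else (\<lambda>_. T))"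
    using \<tau> by (simp add: is_tau_u_def)
  ultimately show ?thesis by blast
qed

lemma upper_game:
  assumes \<rho>u: "is_rho_u M F T U \<rho>u" and \<tau>u: "is_tau_u M F T U \<tau>u"
  shows "upper_value M F T U = dynkin_value M F T U"
    and "(SUP \<tau>\<in>stops 0. payoff M U (rho_star M F T U \<rho>u \<tau>) \<tau>) = dynkin_value M F T U"
    and "(INF r\<in>SII. payoff M U (r (tau_star M F T U \<tau>u r)) (tau_star M F T U \<tau>u r)) = dynkin_value M F T U"
proof -
  obtain C where C: "\<And>\<rho> \<tau>. \<rho> \<in> stops 0 \<Longrightarrow> \<tau> \<in> stops 0 \<Longrightarrow> \<bar>payoff M U \<rho> \<tau>\<bar> \<le> C"
    using payoff_bounded by blast
  have bdd: "\<bar>payoff M U (r \<tau>) \<tau>\<bar> \<le> C" if "r \<in> SII" "\<tau> \<in> stops 0" for r \<tau>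
    using that by (intro C) (auto simp: strategies_II_def)
  note * = minimax_witnesses[of SII "stops 0" "\<lambda>r \<tau>. payoff M U (r \<tau>) \<tau>" C
      "rho_star M F T U \<rho>u" "dynkin_value M F T U" "tau_star M F T U \<tau>u", OF _ rho_star_strategy[OF \<rho>u] rho_star_payoff[OF \<rho>u] tau_star_in_stops[OF \<tau>u]]
  show "upper_value M F T U = dynkin_value M F T U" unfolding upper_value_def by (rule *(1)) (erule (1) bdd, assumption+, erule tau_star_payoff[OF \<tau>u])
  show "(SUP \<tau>\<in>stops 0. payoff M U (rho_star M F T U \<rho>u \<tau>) \<tau>) = dynkin_value M F T U" by (rule *(2)) (erule (1) bdd, assumption+, erule tau_star_payoff[OF \<tau>u])
  show "(INF r\<in>SII. payoff M U (r (tau_star M F T U \<tau>u r)) (tau_star M F T U \<tau>u r)) = dynkin_value M F T U"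
    by (rule *(3)) (erule (1) bdd, assumption+, erule tau_star_payoff[OF \<tau>u])
qed

lemma lower_game:
  assumes \<rho>u: "is_rho_u M F T U \<rho>u" and \<tau>u: "is_tau_u M F T U \<tau>u"
  shows "lower_value M F T U = dynkin_value M F T U"
    and "(INF \<rho>\<in>stops 0. payoff M U \<rho> (tau_star2 M F T U \<tau>u \<rho>)) = dynkin_value M F T U"
    and "(SUP s\<in>SI. payoff M U (rho_star2 M F T U \<rho>u s) (s (rho_star2 M F T U \<rho>u s))) = dynkin_value M F T U"
proof -
  obtain C where C: "\<And>\<rho> \<tau>. \<rho> \<in> stops 0 \<Longrightarrow> \<tau> \<in> stops 0 \<Longrightarrow> \<bar>payoff M U \<rho> \<tau>\<bar> \<le> C"
    using payoff_bounded by blast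
  have bdd: "\<bar>payoff M U \<rho> (s \<rho>)\<bar> \<le> C" if "s \<in> SI" "\<rho> \<in> stops 0" for s \<rho>
    using that by (intro C) (auto simp: strategies_I_def)
  note * = maximin_witnesses[of SI "stops 0" "\<lambda>s \<rho>. payoff M U \<rho> (s \<rho>)" C
      "tau_star2 M F T U \<tau>u" "dynkin_value M F T U" "rho_star2 M F T U \<rho>u", OF _ tau_star2_strategy[OF \<tau>u] tau_star2_payoff[OF \<tau>u] rho_star2_in_stops[OF \<rho>u]]
  show "lower_value M F T U = dynkin_value M F T U" unfolding lower_value_def by (rule *(1)) (erule (1) bdd, assumption+, erule rho_star2_payoff[OF \<rho>u])
  show "(INF \<rho>\<in>stops 0. payoff M U \<rho> (tau_star2 M F T U \<tau>u \<rho>)) = dynkin_value M F T U" by (rule *(2)) (erule (1) bdd, assumption+, erule rho_star2_payoff[OF \<rho>u])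
  show "(SUP s\<in>SI. payoff M U (rho_star2 M F T U \<rho>u s) (s (rho_star2 M F T U \<rho>u s))) = dynkin_value M F T U"
    by (rule *(3)) (erule (1) bdd, assumption+, erule rho_star2_payoff[OF \<rho>u])
qed

end

theorem theorem2p1:
  fixes M :: "'a measure" and F :: "nat \<Rightarrow> 'a measure" and T :: nat
    and U :: "nat \<Rightarrow> nat \<Rightarrow> 'a \<Rightarrow> real"
  assumes "prob_space M"
    and "filtration (space M) F"
    and "\<And>t. t \<le> T \<Longrightarrow> subalgebra M (F t)"
    and "null_sets M \<subseteq> sets (F 0)"
    and "\<exists>C. \<forall>s\<le>T. \<forall>t\<le>T. \<forall>\<omega>\<in>space M. \<bar>U s t \<omega>\<bar> \<le> C"
    and "\<And>s t. s \<le> T \<Longrightarrow> t \<le> T \<Longrightarrow> U s t \<in> borel_measurable (F (max s t))"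
  shows "upper_value M F T U = dynkin_value M F T U \<and>
    lower_value M F T U = dynkin_value M F T U \<and>
    (\<forall>\<rho>u \<tau>u. is_rho_u M F T U \<rho>u \<and> is_tau_u M F T U \<tau>u \<longrightarrow>
      (rho_star M F T U \<rho>u \<in> strategies_II M F T \<and>
       tau_star M F T U \<tau>u \<in> strategies_II M F T \<rightarrow> stopping_times F T 0 \<and>
       upper_value M F T U =
         (SUP \<tau>\<in>stopping_times F T 0. payoff M U (rho_star M F T U \<rho>u \<tau>) \<tau>) \<and>
       upper_value M F T U =
         (INF r\<in>strategies_II M F T.
            payoff M U (r (tau_star M F T U \<tau>u r)) (tau_star M F T U \<tau>u r))) \<and>
      (tau_star2 M F T U \<tau>u \<in> strategies_I M F T \<and>
       rho_star2 M F T U \<rho>u \<in> strategies_I M F T \<rightarrow> stopping_times F T 0 \<and>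
       lower_value M F T U =
         (INF \<rho>\<in>stopping_times F T 0. payoff M U \<rho> (tau_star2 M F T U \<tau>u \<rho>)) \<and>
       lower_value M F T U =
         (SUP s\<in>strategies_I M F T.
            payoff M U (rho_star2 M F T U \<rho>u s) (s (rho_star2 M F T U \<rho>u s)))))"
proof -
  interpret stopping_game M F T U
    using assms by (intro stopping_game.intro finite_horizon.intro
        finite_horizon_axioms.intro stopping_game_axioms.intro) auto
  obtain \<rho>0 \<tau>0 where u0: "is_rho_u M F T U \<rho>0" "is_tau_u M F T U \<tau>0"
    using optimizers_ex by blast
  have val: "upper_value M F T U = dynkin_value M F T U" "lower_value M F T U = dynkin_value M F T U"
    using upper_game(1)[OF u0] lower_game(1)[OF u0] by auto
  show ?thesis
    unfolding val
    using rho_star_strategy tau_star_in_stops tau_star2_strategy rho_star2_in_stops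
      upper_game(2,3) lower_game(2,3)
    by auto
qed

end
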